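(* Let $\frac{d}{dt}x=f(x,u)$ be a $G$-invariant system with $G$-equivariant output $y=h(x,u)$. Then $\frac{d}{dt}\hat x=F(\hat x,u,y)$ is a $G$-invariant pre-observer for this system if and only if $$F(\hat x,u,y)=f(\hat x,u)+\sum_{i=1}^n \mathcal{L}_i\bigl(I(\hat x,u),E(\hat x,u,y)\bigr)\,w_i(\hat x),$$ where $E$ is an invariant output error, $(\hat x,u)\mapsto I(\hat x,u)\in\mathbb{R}^{n+m-r}$ is a full-rank invariant function, the $\mathcal{L}_i$ ($i=1,\dots,n$) are smooth functions such that $\mathcal{L}_i\bigl(I(\hat x,u),0\bigr)=0$ for all $(\hat x,u)$, and $(w_1,\dots,w_n)$ is an invariant frame.
   Context: Setting. $\mathcal X\subset\mathbb{R}^n$, $\mathcal U\subset\mathbb{R}^m$, $\mathcal Y\subset\mathbb{R}^p$ are open, $p\le n$, and $f:\mathcal X\times\mathcal U\to\mathbb{R}^n$, $h:\mathcal X\times\mathcal U\to\mathcal Y$ are smooth. $G$ is a Lie group of dimension $r\le n$ with identity $e$. A (local) transformation group $(\phi_g)_{g\in G}$ on an open set $\Sigma$ is a smooth map $(g,\xi)\mapsto\phi_g(\xi)\in\Sigma$ with $\phi_e(\xi)=\xi$ and $\phi_{g_2}(\phi_{g_1}(\xi))=\phi_{g_2g_1}(\xi)$; it is local if $\phi_g(\xi)$ is defined only for $g$ near $e$ and the composition law is imposed only where it makes sense. $G$ acts by local transformation groups $\varphi_g$ on $\mathcal X$, $\psi_g$ on $\mathcal U$, and $\varrho_g$ on $\mathcal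 Y$. Standing assumption: for each $x$ the map $g\mapsto\varphi_g(x)$ has full rank $r$. Local convention: all statements are local. "For all $g$" means for all $g$ sufficiently near $e$, and "for all" points means for all generic points; all functions (such as $E$, $I$, $\mathcal L_i$, $w_i$) are only required to exist locally. Definitions. - The system $\frac{d}{dt}x=f(x,u)$ is $G$-invariant if $f(\varphi_g(x),\psi_g(u))=D\varphi_g(x)\cdot f(x,u)$ for all $g,x,u$. - The output $y=h(x,u)$ is $G$-equivariant if $h(\varphi_g(x),\psi_g(u))=\varrho_g(h(x,u))$ for all $g,x,u$. - The system $\frac{d}{dt}\hat x=F(\hat x,u,y)$ ($F$ smooth) is a pre-observer if $F(x,u,h(x,u))=f(x,u)$ for all $x,u$. It is $G$-invariant if $F(\varphi_g(\hat x),\psi_g(u),\varrho_g(y))=D\varphi_g(\hat x)\cdot F(\hat x,u,y)$ for all $g,\hat x,u,y$. - An invariant output error is a smooth map $(\hat x,u,y)\mapsto E(\hat x,u,y)\in\mathbb{R}^p$ such that: $y\mapsto E(\hat x,u,y)$ is invertible for all $\hat x,u$; $E(\hat x,u,h(\hat x,u))=0$ for all $\hat x,u$; and $E(\varphi_g(\hat x),\psi_g(u),\varrho_g(y))=E(\hat x,u,y)$ for all $g,\hat x,u,y$. - A function $I(\hat x,u)$ is invariant if $I(\varphi_g(\hat x),\psi_g(u))=I(\hat x,u)$ for all $g,\hat x,u$; full-rank means that its Jacobian has rank $n+m-r$. - A vector field $w$ on $\mathcal X$ is $G$-invariant if $w(\varphi_g(x))=D\varphi_g(x)\cdot w(x)$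 for all $g,x$. An invariant frame is a set $(w_1,\dots,w_n)$ of $n$ pointwise linearly independent $G$-invariant vector fields on $\mathcal X$. *)

theory Defs
  imports "HOL-Analysis.Analysis" "HOL-Algebra.Group"
begin

text \<open>
  Smooth maps. The set \<open>S\<close> is always open where these predicates are used; on open subsets of
  Euclidean spaces \<open>Ck_on k\<close> is the usual class of \<open>k\<close> times continuously differentiable maps.
\<close>

primrec Ck_on :: "nat \<Rightarrow> 'a::real_normed_vector set \<Rightarrow> ('a \<Rightarrow> 'b::real_normed_vector) \<Rightarrow> bool" where
  "Ck_on 0 S f \<longleftrightarrow> continuous_on S f"
| "Ck_on (Suc k) S f \<longleftrightarrow>
     (\<forall>x\<in>S. f differentiable (at x)) \<and>
     (\<forall>v. Ck_on k S (\<lambda>x. frechet_derivative f (at x) v))"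

definition smooth_on :: "'a::real_normed_vector set \<Rightarrow> ('a \<Rightarrow> 'b::real_normed_vector) \<Rightarrow> bool" where
  "smooth_on S f \<longleftrightarrow> (\<forall>k. Ck_on k S f)"

definition derivative_rank :: "('a::euclidean_space \<Rightarrow> 'b::euclidean_space) \<Rightarrow> 'a \<Rightarrow> nat" where
  "derivative_rank f x = dim (range (frechet_derivative f (at x)))"

definition smoothly_invertible_on :: "'a::euclidean_space set \<Rightarrow> ('a \<Rightarrow> 'b::euclidean_space) \<Rightarrow> bool" where
  "smoothly_invertible_on S f \<longleftrightarrow>
     smooth_on S f \<and> open (f ` S) \<and>
     (\<exists>k. smooth_on (f ` S) k \<and> (\<forall>y\<in>S. k (f y) = y))"

text \<open>
  Lie groups. A chart is a pair \<open>(V, c)\<close> of an open set and a homeomorphism of \<open>V\<close> onto an open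
  subset of \<open>real^'r\<close>; its inverse is \<open>inv_into V c\<close>. The group occupies its whole type, whose
  type classes provide the (Hausdorff, second countable) manifold topology.
\<close>

definition chart :: "'g::topological_space set \<Rightarrow> ('g \<Rightarrow> real^'r) \<Rightarrow> bool" where
  "chart V c \<longleftrightarrow> open V \<and> open (c ` V) \<and> homeomorphism V (c ` V) c (inv_into V c)"

definition smooth_atlas :: "('g::topological_space set \<times> ('g \<Rightarrow> real^'r)) set \<Rightarrow> bool" where
  "smooth_atlas \<A> \<longleftrightarrow>
     (\<forall>(V, c)\<in>\<A>. chart V c) \<and>
     (\<Union>(V, c)\<in>\<A>. V) = UNIV \<and>
     (\<forall>(V, c)\<in>\<A>. \<forall>(V', c')\<in>\<A>. smooth_on (c ` (V \<inter> V')) (\<lambda>a. c' (inv_into V c a)))"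

locale lie_group = group G
  for G :: "'g::{t2_space, second_countable_topology} monoid" (structure) +
  fixes \<A> :: "('g set \<times> ('g \<Rightarrow> real^'r)) set"
  assumes carrier_UNIV: "carrier G = UNIV"
    and atlas: "smooth_atlas \<A>"
    and mult_continuous: "continuous_on UNIV (\<lambda>(a, b). a \<otimes> b)"
    and inverse_continuous: "continuous_on UNIV (\<lambda>a. inv a)"
    and mult_smooth:
      "\<And>V1 c1 V2 c2 V3 c3. (V1, c1) \<in> \<A> \<Longrightarrow> (V2, c2) \<in> \<A> \<Longrightarrow> (V3, c3) \<in> \<A> \<Longrightarrow>
         smooth_on {(s, t). s \<in> c1 ` V1 \<and> t \<in> c2 ` V2 \<and> inv_into V1 c1 s \<otimes> inv_into V2 c2 t \<in> V3}
           (\<lambda>(s, t). c3 (inv_into V1 c1 s \<otimes> inv_into V2 c2 t))"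
    and inverse_smooth:
      "\<And>V1 c1 V2 c2. (V1, c1) \<in> \<A> \<Longrightarrow> (V2, c2) \<in> \<A> \<Longrightarrow>
         smooth_on {s. s \<in> c1 ` V1 \<and> inv (inv_into V1 c1 s) \<in> V2}
           (\<lambda>s. c2 (inv (inv_into V1 c1 s)))"

text \<open>
  A local transformation group on \<open>\<Sigma>\<close>: \<open>\<phi> g \<xi>\<close> is meaningful for \<open>(g, \<xi>)\<close> in the open set \<open>D\<close>,
  a neighbourhood of \<open>{e} \<times> \<Sigma>\<close>. A global action is the case \<open>D = UNIV \<times> \<Sigma>\<close>.
\<close>

definition local_transformation_group ::
  "'g::topological_space monoid \<Rightarrow> ('g set \<times> ('g \<Rightarrow> real^'r)) set \<Rightarrow>
   'a::euclidean_space set \<Rightarrow> ('g \<times> 'a) set \<Rightarrow> ('g \<Rightarrow> 'a \<Rightarrow> 'a) \<Rightarrow> bool" where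
  "local_transformation_group G \<A> \<Sigma> D \<phi> \<longleftrightarrow>
     open D \<and> D \<subseteq> UNIV \<times> \<Sigma> \<and> {\<one>\<^bsub>G\<^esub>} \<times> \<Sigma> \<subseteq> D \<and>
     (\<forall>(g, \<xi>)\<in>D. \<phi> g \<xi> \<in> \<Sigma>) \<and>
     (\<forall>(V, c)\<in>\<A>. smooth_on {(s, \<xi>). s \<in> c ` V \<and> (inv_into V c s, \<xi>) \<in> D}
                    (\<lambda>(s, \<xi>). \<phi> (inv_into V c s) \<xi>)) \<and>
     (\<forall>\<xi>\<in>\<Sigma>. \<phi> \<one>\<^bsub>G\<^esub> \<xi> = \<xi>) \<and>
     (\<forall>g1 g2 \<xi>. (g1, \<xi>) \<in> D \<and> (g2, \<phi> g1 \<xi>) \<in> D \<and> (g2 \<otimes>\<^bsub>G\<^esub> g1, \<xi>) \<in> D \<longrightarrow>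
        \<phi> g2 (\<phi> g1 \<xi>) = \<phi> (g2 \<otimes>\<^bsub>G\<^esub> g1) \<xi>)"

definition full_rank_action ::
  "('g::topological_space set \<times> ('g \<Rightarrow> real^'r)) set \<Rightarrow>
   ('g \<times> 'a::euclidean_space) set \<Rightarrow> ('g \<Rightarrow> 'a \<Rightarrow> 'a) \<Rightarrow> bool" where
  "full_rank_action \<A> D \<phi> \<longleftrightarrow>
     (\<forall>(g, \<xi>)\<in>D. \<forall>(V, c)\<in>\<A>. g \<in> V \<longrightarrow>
        derivative_rank (\<lambda>s. \<phi> (inv_into V c s) \<xi>) (c g) = CARD('r))"

text \<open>
  \<open>near_identity e S P\<close> is the local reading of ``\<open>P g \<xi>\<close> for all \<open>g\<close> (near \<open>e\<close>) and all \<open>\<xi> \<in> S\<close>'':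
  how near \<open>g\<close> has to be to \<open>e\<close> may depend on \<open>\<xi>\<close>, but locally uniformly, exactly as for the domain
  of a local transformation group.
\<close>

definition near_identity ::
  "'g::topological_space \<Rightarrow> 'a::topological_space set \<Rightarrow> ('g \<Rightarrow> 'a \<Rightarrow> bool) \<Rightarrow> bool" where
  "near_identity e S P \<longleftrightarrow>
     (\<exists>\<Omega>. open \<Omega> \<and> {e} \<times> S \<subseteq> \<Omega> \<and> (\<forall>(g, \<xi>)\<in>\<Omega>. \<xi> \<in> S \<longrightarrow> P g \<xi>))"

text \<open>
  In the following, \<open>\<phi>\<close>, \<open>\<psi>\<close>, \<open>\<rho>\<close> act on states, inputs and outputs, and \<open>e\<close> is the identity of the group.
\<close>

definition invariant_system ::
  "'g::topological_space \<Rightarrow> ('g \<Rightarrow> real^'n \<Rightarrow> real^'n) \<Rightarrow> ('g \<Rightarrow> real^'m \<Rightarrow> real^'m) \<Rightarrow>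
   ((real^'n) \<times> (real^'m)) set \<Rightarrow> (real^'n \<Rightarrow> real^'m \<Rightarrow> real^'n) \<Rightarrow> bool" where
  "invariant_system e \<phi> \<psi> N f \<longleftrightarrow>
     near_identity e N (\<lambda>g (x, u). f (\<phi> g x) (\<psi> g u) = frechet_derivative (\<phi> g) (at x) (f x u))"

definition equivariant_output ::
  "'g::topological_space \<Rightarrow> ('g \<Rightarrow> real^'n \<Rightarrow> real^'n) \<Rightarrow> ('g \<Rightarrow> real^'m \<Rightarrow> real^'m) \<Rightarrow>
   ('g \<Rightarrow> real^'p \<Rightarrow> real^'p) \<Rightarrow>
   ((real^'n) \<times> (real^'m)) set \<Rightarrow> (real^'n \<Rightarrow> real^'m \<Rightarrow> real^'p) \<Rightarrow> bool" where
  "equivariant_output e \<phi> \<psi> \<rho> N h \<longleftrightarrow>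
     near_identity e N (\<lambda>g (x, u). h (\<phi> g x) (\<psi> g u) = \<rho> g (h x u))"

definition pre_observer ::
  "(real^'n \<Rightarrow> real^'m \<Rightarrow> real^'n) \<Rightarrow> (real^'n \<Rightarrow> real^'m \<Rightarrow> real^'p) \<Rightarrow>
   ((real^'n) \<times> (real^'m) \<times> (real^'p)) set \<Rightarrow> (real^'n \<Rightarrow> real^'m \<Rightarrow> real^'p \<Rightarrow> real^'n) \<Rightarrow> bool" where
  "pre_observer f h W F \<longleftrightarrow>
     smooth_on W (\<lambda>(x, u, y). F x u y) \<and>
     (\<forall>x u. (x, u, h x u) \<in> W \<longrightarrow> F x u (h x u) = f x u)"

definition invariant_pre_observer ::
  "'g::topological_space \<Rightarrow> ('g \<Rightarrow> real^'n \<Rightarrow> real^'n) \<Rightarrow> ('g \<Rightarrow> real^'m \<Rightarrow> real^'m) \<Rightarrow>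
   ('g \<Rightarrow> real^'p \<Rightarrow> real^'p) \<Rightarrow>
   (real^'n \<Rightarrow> real^'m \<Rightarrow> real^'n) \<Rightarrow> (real^'n \<Rightarrow> real^'m \<Rightarrow> real^'p) \<Rightarrow>
   ((real^'n) \<times> (real^'m) \<times> (real^'p)) set \<Rightarrow> (real^'n \<Rightarrow> real^'m \<Rightarrow> real^'p \<Rightarrow> real^'n) \<Rightarrow> bool" where
  "invariant_pre_observer e \<phi> \<psi> \<rho> f h W F \<longleftrightarrow>
     pre_observer f h W F \<and>
     near_identity e W (\<lambda>g (x, u, y).
       F (\<phi> g x) (\<psi> g u) (\<rho> g y) = frechet_derivative (\<phi> g) (at x) (F x u y))"

text \<open>
  Invertibility of \<open>y \<mapsto> E x u y\<close> is as a map from the fibre of the (local) domain \<open>W\<close> over \<open>(x, u)\<close>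
  onto its image.
\<close>

definition invariant_output_error ::
  "'g::topological_space \<Rightarrow> ('g \<Rightarrow> real^'n \<Rightarrow> real^'n) \<Rightarrow> ('g \<Rightarrow> real^'m \<Rightarrow> real^'m) \<Rightarrow>
   ('g \<Rightarrow> real^'p \<Rightarrow> real^'p) \<Rightarrow> (real^'n \<Rightarrow> real^'m \<Rightarrow> real^'p) \<Rightarrow>
   ((real^'n) \<times> (real^'m) \<times> (real^'p)) set \<Rightarrow> (real^'n \<Rightarrow> real^'m \<Rightarrow> real^'p \<Rightarrow> real^'p) \<Rightarrow> bool" where
  "invariant_output_error e \<phi> \<psi> \<rho> h W E \<longleftrightarrow>
     smooth_on W (\<lambda>(x, u, y). E x u y) \<and>
     (\<forall>x u. smoothly_invertible_on {y. (x, u, y) \<in> W} (E x u)) \<and>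
     (\<forall>x u. (x, u, h x u) \<in> W \<longrightarrow> E x u (h x u) = 0) \<and>
     near_identity e W (\<lambda>g (x, u, y). E (\<phi> g x) (\<psi> g u) (\<rho> g y) = E x u y)"

definition invariant_function ::
  "'g::topological_space \<Rightarrow> ('g \<Rightarrow> real^'n \<Rightarrow> real^'n) \<Rightarrow> ('g \<Rightarrow> real^'m \<Rightarrow> real^'m) \<Rightarrow>
   ((real^'n) \<times> (real^'m)) set \<Rightarrow> (real^'n \<Rightarrow> real^'m \<Rightarrow> real^'k) \<Rightarrow> bool" where
  "invariant_function e \<phi> \<psi> N I \<longleftrightarrow>
     smooth_on N (\<lambda>(x, u). I x u) \<and>
     near_identity e N (\<lambda>g (x, u). I (\<phi> g x) (\<psi> g u) = I x u)"

text \<open>Full rank is rank \<open>n + m - r\<close>, which is the number \<open>CARD('k)\<close> of components where this is used.\<close>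

definition full_rank_function ::
  "((real^'n) \<times> (real^'m)) set \<Rightarrow> (real^'n \<Rightarrow> real^'m \<Rightarrow> real^'k) \<Rightarrow> bool" where
  "full_rank_function N I \<longleftrightarrow> (\<forall>z\<in>N. derivative_rank (\<lambda>(x, u). I x u) z = CARD('k))"

definition invariant_vector_field ::
  "'g::topological_space \<Rightarrow> ('g \<Rightarrow> real^'n \<Rightarrow> real^'n) \<Rightarrow> (real^'n) set \<Rightarrow>
   (real^'n \<Rightarrow> real^'n) \<Rightarrow> bool" where
  "invariant_vector_field e \<phi> A w \<longleftrightarrow>
     smooth_on A w \<and>
     near_identity e A (\<lambda>g x. w (\<phi> g x) = frechet_derivative (\<phi> g) (at x) (w x))"

definition invariant_frame ::
  "'g::topological_space \<Rightarrow> ('g \<Rightarrow> real^'n \<Rightarrow> real^'n) \<Rightarrow> (real^'n) set \<Rightarrow>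
   ('n \<Rightarrow> real^'n \<Rightarrow> real^'n) \<Rightarrow> bool" where
  "invariant_frame e \<phi> A w \<longleftrightarrow>
     (\<forall>i. invariant_vector_field e \<phi> A (w i)) \<and>
     (\<forall>x\<in>A. inj (\<lambda>i. w i x) \<and> independent (range (\<lambda>i. w i x)))"

end

theory Submission
  imports Defs
begin

text \<open>
  The proof normalises by a moving frame. Since the action on the state space has full rank, the
  inverse function theorem writes every state \<open>x\<close> near \<open>x\<^sub>0\<close> uniquely as \<open>x = \<phi> (a x) (\<zeta> x)\<close> with
  \<open>\<zeta> x\<close> in a fixed affine cross-section of dimension \<open>n - r\<close>, and uniqueness forces
  \<open>a (\<phi> g x) = g \<otimes> a x\<close> and \<open>\<zeta> (\<phi> g x) = \<zeta> x\<close>. Acting by \<open>inv (a x)\<close> therefore sends points of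
  one orbit to the same normal form. With \<open>\<nu> = \<psi> (inv (a x)) u\<close>, the pair \<open>(\<zeta> x, \<nu>)\<close> is the full-rank
  invariant, \<open>\<rho> (inv (a x)) y - h (\<zeta> x) \<nu>\<close> is the output error, and transporting the standard basis
  from \<open>\<zeta> x\<close> to \<open>x\<close> by \<open>D(\<phi> (a x))\<close> gives the invariant frame. The coefficients of \<open>F - f\<close> in
  that frame are the coordinates of \<open>F - f\<close> evaluated at the normal form, hence smooth functions of
  the invariant and the output error.
\<close>

text \<open>The obstacle is locality: invariance may be applied only to group elements near the
  identity, and how near depends on the point. The frame is therefore based with
  \<open>a x0 = \<one>\<close>, so that for \<open>x\<close> near \<open>x0\<close> the element
  \<open>inv (a x)\<close> is small enough to be inserted into the invariance of \<open>f\<close>,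
  \<open>h\<close> and \<open>F\<close>. Outputs range over the whole open set \<open>Y\<close>, and
  no compactness bounds this smallness uniformly in \<open>y\<close>. Hence \<open>W\<close> is only
  an open neighbourhood of \<open>{x0} \<times> {u0} \<times> Y\<close>, in general not a product;
  it is cut out of the interior of the set where normalisation is legitimate. Subtracting the
  predicted normalised output makes the error vanish for \<open>y = h x u\<close>. Adding the same
  term back recovers the normalised output from the invariant and the error, which is why the
  coefficients factor through these two. In the converse direction the coefficients are constant
  along orbits, while \<open>f\<close> and the frame are transported by the linear map
  \<open>D(\<phi> g)\<close>.\<close>

section \<open>Calculus of smooth maps\<close>

lemma Ck_on_cong:
  assumes "open S" "\<And>x. x \<in> S \<Longrightarrow> f x = g x" "Ck_on k S f"
  shows "Ck_on k S g"
  using assms(2,3)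
proof (induction k arbitrary: f g)
  case 0
  then show ?case by (simp cong: continuous_on_cong)
next
  case (Suc k)
  have fd: "frechet_derivative f (at x) = frechet_derivative g (at x)" if "x \<in> S" for x
    using frechet_derivative_transform_within_open[of f x S g] Suc.prems assms(1) that by simp
  have "g differentiable at x" if "x \<in> S" for x
    using Suc.prems assms(1) that has_derivative_transform_within_open
    unfolding differentiable_def by (metis Ck_on.simps(2) differentiable_def)
  moreover have "Ck_on k S (\<lambda>x. frechet_derivative g (at x) v)" for v
    using Suc.IH[of "\<lambda>x. frechet_derivative f (at x) v"] Suc.prems fd by simp
  ultimately show ?case by simp
qed

lemma Ck_on_subset: "Ck_on k S f \<Longrightarrow> T \<subseteq> S \<Longrightarrow> Ck_on k T f"
  by (induction k arbitrary: f) (auto intro: continuous_on_subset)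

text \<open>Lets the closure proofs use any explicit formula for the derivative in place of
  \<open>frechet_derivative\<close>, with which it agrees on the open set.\<close>

lemma Ck_on_SucI:
  assumes "open S" "\<And>x. x \<in> S \<Longrightarrow> (f has_derivative f' x) (at x)" "\<And>v. Ck_on k S (\<lambda>x. f' x v)"
  shows "Ck_on (Suc k) S f"
proof -
  have "frechet_derivative f (at x) = f' x" if "x \<in> S" for x
    using assms(2)[OF that] frechet_derivative_at by metis
  then have "Ck_on k S (\<lambda>x. frechet_derivative f (at x) v)" for v
    using Ck_on_cong[OF assms(1) _ assms(3)[of v]] by auto
  then show ?thesis using assms(2) by (auto simp: differentiable_def)
qed

lemma Ck_on_SucD:
  assumes "Ck_on (Suc k) S f" "x \<in> S"
  shows "(f has_derivative frechet_derivative f (at x)) (at x)"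
  using assms frechet_derivative_works by auto

lemma Ck_on_continuous: "Ck_on k S f \<Longrightarrow> continuous_on S f"
  by (cases k) (auto intro!: continuous_at_imp_continuous_on differentiable_imp_continuous_within)

lemma Ck_on_Suc_imp: "Ck_on (Suc k) S f \<Longrightarrow> Ck_on k S f"
proof (induction k arbitrary: f)
  case 0
  then show ?case using Ck_on_continuous[of "Suc 0" S f] by simp
next
  case (Suc k)
  then show ?case by (metis Ck_on.simps(2))
qed

lemma Ck_on_const: "Ck_on k S (\<lambda>x. c)"
  by (induction k arbitrary: c) auto

lemma Ck_on_bounded_linear:
  assumes "open S" "bounded_linear l" "Ck_on k S f"
  shows "Ck_on k S (\<lambda>x. l (f x))"
  using assms(3)
proof (induction k arbitrary: f)
  case 0
  then show ?case using assms(2) by (auto intro: bounded_linear.continuous_on)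
next
  case (Suc k)
  show ?case
    by (rule Ck_on_SucI[OF assms(1), where f' = "\<lambda>x v. l (frechet_derivative f (at x) v)"])
      (use Suc in \<open>auto intro!: bounded_linear.has_derivative[OF assms(2)] Ck_on_SucD\<close>)
qed

lemma Ck_on_add:
  assumes "open S" "Ck_on k S f" "Ck_on k S g"
  shows "Ck_on k S (\<lambda>x. f x + g x)"
  using assms(2,3)
proof (induction k arbitrary: f g)
  case 0
  then show ?case by (auto intro: continuous_on_add)
next
  case (Suc k)
  show ?case
    by (rule Ck_on_SucI[OF assms(1),
          where f' = "\<lambda>x v. frechet_derivative f (at x) v + frechet_derivative g (at x) v"])
      (use Suc in \<open>auto intro!: has_derivative_add Ck_on_SucD\<close>)
qed

lemma Ck_on_bilinear:
  assumes "open S" "bounded_bilinear b" "Ck_on k S f" "Ck_on k S g"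
  shows "Ck_on k S (\<lambda>x. b (f x) (g x))"
  using assms(3,4)
proof (induction k arbitrary: f g)
  case 0
  then show ?case using assms(2) by (auto intro: bounded_bilinear.continuous_on)
next
  case (Suc k)
  show ?case
  proof (rule Ck_on_SucI[OF assms(1)])
    show "((\<lambda>x. b (f x) (g x)) has_derivative
        (\<lambda>v. b (f x) (frechet_derivative g (at x) v) + b (frechet_derivative f (at x) v) (g x))) (at x)"
      if "x \<in> S" for x
      by (rule bounded_bilinear.FDERIV[OF assms(2)]) (use Suc.prems that in \<open>auto intro: Ck_on_SucD\<close>)
    show "Ck_on k S (\<lambda>x. b (f x) (frechet_derivative g (at x) v) + b (frechet_derivative f (at x) v) (g x))" for v
      by (intro Ck_on_add Suc.IH assms(1)) (use Suc.prems Ck_on_Suc_imp in auto)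
  qed
qed

lemma Ck_on_sum:
  assumes "open S" "\<And>i. i \<in> J \<Longrightarrow> Ck_on k S (f i)"
  shows "Ck_on k S (\<lambda>x. \<Sum>i\<in>J. f i x)"
  using assms(2) by (induction J rule: infinite_finite_induct) (auto intro: Ck_on_const Ck_on_add assms(1))

lemma Ck_on_Pair:
  assumes "open S" "Ck_on k S f" "Ck_on k S g"
  shows "Ck_on k S (\<lambda>x. (f x, g x))"
proof -
  have "Ck_on k S (\<lambda>x. (f x, 0) + (0, g x))"
    by (intro Ck_on_add assms Ck_on_bounded_linear[where l = "\<lambda>z. (z, 0)"]
        Ck_on_bounded_linear[where l = "\<lambda>z. (0, z)"] bounded_linear_Pair bounded_linear_ident bounded_linear_zero)
  then show ?thesis by simp
qed

text \<open>The chain rule evaluates the derivative of \<open>g\<close> in a direction that moves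
  with \<open>x\<close>, whereas \<open>Ck_on\<close> controls fixed directions only. Expanding the
  moving direction in \<open>Basis\<close> leaves scalar factors from the derivative of
  \<open>f\<close> times derivatives of \<open>g\<close> in fixed directions, and to the latter the
  induction hypothesis applies.\<close>

lemma Ck_on_compose:
  fixes f :: "'a::real_normed_vector \<Rightarrow> 'b::euclidean_space" and g :: "'b \<Rightarrow> 'c::real_normed_vector"
  assumes "open S" "open T" "f ` S \<subseteq> T" "Ck_on k S f" "Ck_on k T g"
  shows "Ck_on k S (\<lambda>x. g (f x))"
  using assms(4,5)
proof (induction k arbitrary: g)
  case 0
  then show ?case using assms(3) by (auto intro: continuous_on_compose2)
next
  case (Suc k)
  let ?f' = "\<lambda>x. frechet_derivative f (at x)" and ?g' = "\<lambda>y. frechet_derivative g (at y)"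
  show ?case
  proof (rule Ck_on_SucI[OF assms(1)])
    fix x assume x: "x \<in> S"
    have g: "(g has_derivative ?g' (f x)) (at (f x))"
      using Suc.prems(2) x assms(3) by (intro Ck_on_SucD) auto
    then have lin: "linear (?g' (f x))" by (rule has_derivative_linear)
    have "?g' (f x) (\<Sum>b\<in>Basis. (w \<bullet> b) *\<^sub>R b) = (\<Sum>b\<in>Basis. (w \<bullet> b) *\<^sub>R ?g' (f x) b)" for w
      by (simp only: linear_sum[OF lin] linear_scale[OF lin])
    then have expand: "?g' (f x) w = (\<Sum>b\<in>Basis. (w \<bullet> b) *\<^sub>R ?g' (f x) b)" for w
      using euclidean_representation[of w] by metis
    have "((\<lambda>x. g (f x)) has_derivative (\<lambda>v. ?g' (f x) (?f' x v))) (at x)"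
      using has_derivative_compose[OF Ck_on_SucD[OF Suc.prems(1) x] g] .
    then show "((\<lambda>x. g (f x)) has_derivative (\<lambda>v. \<Sum>b\<in>Basis. (?f' x v \<bullet> b) *\<^sub>R ?g' (f x) b)) (at x)"
      by (rule has_derivative_eq_rhs) (rule ext, rule expand)
  next
    fix v
    show "Ck_on k S (\<lambda>x. \<Sum>b\<in>Basis. (?f' x v \<bullet> b) *\<^sub>R ?g' (f x) b)"
    proof (intro Ck_on_sum Ck_on_bilinear[OF _ bounded_bilinear_scaleR] assms(1))
      fix b :: 'b
      show "Ck_on k S (\<lambda>x. ?f' x v \<bullet> b)"
        by (rule Ck_on_bounded_linear[OF assms(1) bounded_linear_inner_left]) (use Suc.prems(1) in simp)
      show "Ck_on k S (\<lambda>x. ?g' (f x) b)"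
        by (rule Suc.IH[OF Ck_on_Suc_imp[OF Suc.prems(1)]]) (use Suc.prems(2) in simp)
    qed
  qed
qed

lemma Ck_on_real_inverse:
  fixes f :: "'a::real_normed_vector \<Rightarrow> real"
  assumes "open S" "\<And>x. x \<in> S \<Longrightarrow> f x \<noteq> 0" "Ck_on k S f"
  shows "Ck_on k S (\<lambda>x. inverse (f x))"
  using assms(3)
proof (induction k)
  case 0
  then show ?case using assms(2) by (auto intro: continuous_on_inverse)
next
  case (Suc k)
  have "Ck_on k S (\<lambda>x. inverse (f x))"
    by (intro Suc.IH Ck_on_Suc_imp[OF Suc.prems])
  then have "Ck_on k S (\<lambda>x. - (inverse (f x) * frechet_derivative f (at x) v * inverse (f x)))" for v
    by (intro Ck_on_bounded_linear[where l = uminus] bounded_linear_minus bounded_linear_ident assms(1)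
        Ck_on_bilinear[where b = "(*)"] bounded_bilinear_mult) (use Suc.prems in auto)
  then show ?case
    using Ck_on_SucI[OF assms(1) Deriv.has_derivative_inverse[OF assms(2) Ck_on_SucD[OF Suc.prems]]] by blast
qed

lemma Ck_on_prod:
  fixes f :: "'i \<Rightarrow> 'a::real_normed_vector \<Rightarrow> real"
  assumes "open S" "\<And>i. i \<in> J \<Longrightarrow> Ck_on k S (f i)"
  shows "Ck_on k S (\<lambda>x. \<Prod>i\<in>J. f i x)"
  using assms(2)
  by (induction J rule: infinite_finite_induct)
    (auto intro!: Ck_on_const Ck_on_bilinear[where b = "(*)"] bounded_bilinear_mult assms(1))

lemma Ck_on_det:
  fixes A :: "'a::real_normed_vector \<Rightarrow> real^'n^'n"
  assumes "open S" "\<And>i j. Ck_on k S (\<lambda>x. A x $ i $ j)"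
  shows "Ck_on k S (\<lambda>x. det (A x))"
  unfolding det_def
  by (intro Ck_on_sum Ck_on_bilinear[where b = "(*)"] bounded_bilinear_mult assms Ck_on_const Ck_on_prod)

lemma Ck_on_vec:
  fixes f :: "'a::real_normed_vector \<Rightarrow> real^'n"
  assumes "open S" "\<And>i. Ck_on k S (\<lambda>x. f x $ i)"
  shows "Ck_on k S f"
proof -
  have "Ck_on k S (\<lambda>x. \<Sum>i\<in>UNIV. (f x $ i) *\<^sub>R axis i 1)"
    by (intro Ck_on_sum Ck_on_bilinear[OF _ bounded_bilinear_scaleR] assms Ck_on_const)
  moreover have "(\<Sum>i\<in>UNIV. (f x $ i) *\<^sub>R axis i 1) = f x" for x
    using basis_expansion[of "f x"] by (simp add: scalar_mult_eq_scaleR)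
  ultimately show ?thesis by (rule Ck_on_cong[OF assms(1), rotated])
qed

text \<open>Cramer's rule: every coordinate of the solution is a quotient of determinants in the
  entries of \<open>A x\<close>. In \<open>C x l\<close> column \<open>l\<close> of that matrix is
  replaced by \<open>v\<close>.\<close>

lemma Ck_on_inv_linear:
  fixes A :: "'a::real_normed_vector \<Rightarrow> real^'n \<Rightarrow> real^'n"
  assumes "open S" "\<And>x. x \<in> S \<Longrightarrow> linear (A x)" "\<And>x. x \<in> S \<Longrightarrow> bij (A x)"
    and "\<And>v. Ck_on k S (\<lambda>x. A x v)"
  shows "Ck_on k S (\<lambda>x. inv_into UNIV (A x) v)"
proof -
  define C where "C x l = (\<chi> i j. if j = l then v $ i else matrix (A x) $ i $ j)" for x l
  have entry: "Ck_on k S (\<lambda>x. matrix (A x) $ i $ j)" for i j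
    unfolding matrix_def
    by (simp, intro Ck_on_bounded_linear[where l = "\<lambda>w. w $ i"] bounded_linear_vec_nth assms)
  have entryC: "Ck_on k S (\<lambda>x. C x l $ i $ j)" for i j l
    unfolding C_def by (cases "j = l") (simp_all add: entry Ck_on_const)
  have nz: "det (matrix (A x)) \<noteq> 0" if "x \<in> S" for x
    using assms(2,3)[OF that] by (simp add: det_nz_iff_inj bij_is_inj)
  have "Ck_on k S (\<lambda>x. (\<chi> l. det (C x l) * inverse (det (matrix (A x)))))"
    by (rule Ck_on_vec[OF assms(1)], simp, intro Ck_on_bilinear[where b = "(*)"] bounded_bilinear_mult
        Ck_on_det Ck_on_real_inverse assms(1) entry entryC nz)
  moreover have "(\<chi> l. det (C x l) * inverse (det (matrix (A x)))) = inv_into UNIV (A x) v" if "x \<in> S" for x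
  proof -
    have "matrix (A x) *v inv_into UNIV (A x) v = v"
      using assms(2,3)[OF that] by (simp add: matrix_works bij_is_surj surj_f_inv_f)
    with cramer[OF nz[OF that]] show ?thesis by (simp add: C_def divide_inverse)
  qed
  ultimately show ?thesis by (rule Ck_on_cong[OF assms(1), rotated])
qed

section \<open>Closure properties of \<open>smooth_on\<close> and the smooth inverse function
  theorem\<close>

lemma smooth_on_cong:
  assumes "open S" "\<And>x. x \<in> S \<Longrightarrow> f x = g x" "smooth_on S f"
  shows "smooth_on S g"
  using assms Ck_on_cong unfolding smooth_on_def by blast

lemma smooth_on_subset: "smooth_on S f \<Longrightarrow> T \<subseteq> S \<Longrightarrow> smooth_on T f"
  unfolding smooth_on_def using Ck_on_subset by blast

lemma smooth_on_continuous: "smooth_on S f \<Longrightarrow> continuous_on S f"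
  unfolding smooth_on_def using Ck_on_continuous by blast

lemma smooth_on_has_derivative:
  "smooth_on S f \<Longrightarrow> x \<in> S \<Longrightarrow> (f has_derivative frechet_derivative f (at x)) (at x)"
  unfolding smooth_on_def by (rule Ck_on_SucD[of 0]) blast+

lemma smooth_on_differentiable: "smooth_on S f \<Longrightarrow> x \<in> S \<Longrightarrow> f differentiable at x"
  using smooth_on_has_derivative unfolding differentiable_def by blast

lemma smooth_on_frechet_derivative: "smooth_on S f \<Longrightarrow> smooth_on S (\<lambda>x. frechet_derivative f (at x) v)"
proof -
  assume "smooth_on S f"
  then have "Ck_on (Suc k) S f" for k
    unfolding smooth_on_def by blast
  then show ?thesis
    by (simp add: smooth_on_def)
qed

lemma smooth_on_const: "smooth_on S (\<lambda>x. c)"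
  by (simp add: smooth_on_def Ck_on_const)

lemma smooth_on_bounded_linear:
  "open S \<Longrightarrow> bounded_linear l \<Longrightarrow> smooth_on S f \<Longrightarrow> smooth_on S (\<lambda>x. l (f x))"
  using Ck_on_bounded_linear[of S l _ f] by (simp add: smooth_on_def)

lemma smooth_on_linear:
  fixes f :: "'a::euclidean_space \<Rightarrow> 'b::real_normed_vector"
  assumes "open S" "linear f"
  shows "smooth_on S f"
proof -
  have "Ck_on k S (\<lambda>x. x)" for k
    by (cases k) (auto intro!: Ck_on_const Ck_on_SucI[OF assms(1)] has_derivative_ident continuous_intros)
  then show ?thesis
    using assms Ck_on_bounded_linear[of S f _ "\<lambda>x. x"] by (simp add: smooth_on_def linear_conv_bounded_linear)
qed

lemma smooth_on_add: "open S \<Longrightarrow> smooth_on S f \<Longrightarrow> smooth_on S g \<Longrightarrow> smooth_on S (\<lambda>x. f x + g x)"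
  using Ck_on_add[of S _ f g] by (simp add: smooth_on_def)

lemma smooth_on_diff:
  assumes "open S" "smooth_on S f" "smooth_on S g"
  shows "smooth_on S (\<lambda>x. f x - g x)"
proof -
  have "smooth_on S (\<lambda>x. f x + - g x)"
    by (intro smooth_on_add smooth_on_bounded_linear[where l = uminus] bounded_linear_minus bounded_linear_ident assms)
  then show ?thesis by simp
qed

lemma smooth_on_Pair: "open S \<Longrightarrow> smooth_on S f \<Longrightarrow> smooth_on S g \<Longrightarrow> smooth_on S (\<lambda>x. (f x, g x))"
  using Ck_on_Pair[of S _ f g] by (simp add: smooth_on_def)

lemma smooth_on_compose:
  fixes f :: "'a::real_normed_vector \<Rightarrow> 'b::euclidean_space" and g :: "'b \<Rightarrow> 'c::real_normed_vector"
  assumes "smooth_on T g" "open S" "open T" "smooth_on S f" "\<And>x. x \<in> S \<Longrightarrow> f x \<in> T"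
  shows "smooth_on S (\<lambda>x. g (f x))"
proof -
  have "f ` S \<subseteq> T" using assms(5) by blast
  moreover have "Ck_on k S f" "Ck_on k T g" for k
    using assms(1,4) by (simp_all add: smooth_on_def)
  ultimately have "Ck_on k S (\<lambda>x. g (f x))" for k
    by (rule Ck_on_compose[OF assms(2,3)])
  then show ?thesis
    unfolding smooth_on_def by blast
qed

lemma smooth_on_compose2:
  fixes f1 :: "'a::real_normed_vector \<Rightarrow> 'b::euclidean_space" and f2 :: "'a \<Rightarrow> 'c::euclidean_space"
    and g :: "'b \<Rightarrow> 'c \<Rightarrow> 'd::real_normed_vector"
  assumes "smooth_on T (\<lambda>(y, z). g y z)" "open S" "open T" "smooth_on S f1" "smooth_on S f2"
    and "\<And>x. x \<in> S \<Longrightarrow> (f1 x, f2 x) \<in> T"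
  shows "smooth_on S (\<lambda>x. g (f1 x) (f2 x))"
proof -
  have "smooth_on S (\<lambda>x. (f1 x, f2 x))"
    by (rule smooth_on_Pair[OF assms(2,4,5)])
  from smooth_on_compose[OF assms(1,2,3) this assms(6)] show ?thesis
    by simp
qed

lemma smooth_on_ident: "open S \<Longrightarrow> smooth_on S (\<lambda>x::'a::euclidean_space. x)"
  using smooth_on_linear[OF _ linear_id] by (simp add: id_def)

lemma smooth_on_fst: "open S \<Longrightarrow> smooth_on S f \<Longrightarrow> smooth_on S (\<lambda>x. fst (f x))"
  by (rule smooth_on_bounded_linear[OF _ bounded_linear_fst])

lemma smooth_on_snd: "open S \<Longrightarrow> smooth_on S f \<Longrightarrow> smooth_on S (\<lambda>x. snd (f x))"
  by (rule smooth_on_bounded_linear[OF _ bounded_linear_snd])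

text \<open>Bootstrapping: the inverse function theorem gives a continuous inverse \<open>g\<close>
  whose derivative at \<open>y\<close> is the inverse of the derivative of \<open>f\<close> at
  \<open>g y\<close>. If \<open>g\<close> is of class k, then so is this derivative by
  \<open>Ck_on_inv_linear\<close>, and \<open>g\<close> is of class k + 1.\<close>

lemma smooth_inverse_function:
  fixes f :: "real^'n \<Rightarrow> real^'n"
  assumes "open S" "smooth_on S f" "x0 \<in> S" "inj (frechet_derivative f (at x0))"
  obtains N A g where "open N" "N \<subseteq> S" "x0 \<in> N" "open A" "f x0 \<in> A" "homeomorphism N A f g" "smooth_on A g"
proof -
  define f' where "f' x = Blinfun (frechet_derivative f (at x))" for x
  have f': "blinfun_apply (f' x) = frechet_derivative f (at x)" if "x \<in> S" for x
    unfolding f'_def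
    using smooth_on_has_derivative[OF assms(2) that]
    by (intro bounded_linear_Blinfun_apply) (auto dest: has_derivative_bounded_linear)
  have cont: "continuous_on S f'"
  proof (rule continuous_on_blinfun_componentwise)
    fix i
    have "continuous_on S (\<lambda>x. frechet_derivative f (at x) i)"
      using smooth_on_continuous smooth_on_frechet_derivative assms(2) by blast
    then show "continuous_on S (\<lambda>x. blinfun_apply (f' x) i)"
      using f' by (simp cong: continuous_on_cong)
  qed
  have lin: "linear (frechet_derivative f (at x))" if "x \<in> S" for x
    using smooth_on_differentiable[OF assms(2) that] linear_frechet_derivative by blast
  obtain l where l: "linear l" "l \<circ> frechet_derivative f (at x0) = id"
    using linear_injective_left_inverse[OF lin[OF assms(3)] assms(4)] by blast
  have "Blinfun l o\<^sub>L f' x0 = id_blinfun"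
    using l f'[OF assms(3)]
    by (intro blinfun_eqI) (simp add: bounded_linear_Blinfun_apply linear_conv_bounded_linear pointfree_idE)
  from inverse_function_theorem[OF assms(1) _ cont assms(3) this]
  obtain N A g g' where N: "open N" "N \<subseteq> S" "x0 \<in> N" and A: "open A" "f x0 \<in> A" and hom: "homeomorphism N A f g"
    and g: "\<And>y. y \<in> A \<Longrightarrow> (g has_derivative (g' y)) (at y)"
    and g': "\<And>y. y \<in> A \<Longrightarrow> g' y = inv_into UNIV (blinfun_apply (f' (g y)))"
    and bij: "\<And>y. y \<in> A \<Longrightarrow> bij (blinfun_apply (f' (g y)))"
    using f' smooth_on_has_derivative[OF assms(2)] by metis
  have gS: "g ` A \<subseteq> S" using hom N(2) by (auto simp: homeomorphism_def)
  have "Ck_on k A g" for k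
  proof (induction k)
    case 0
    then show ?case using hom by (simp add: homeomorphism_def)
  next
    case (Suc k)
    have "Ck_on k A (\<lambda>y. frechet_derivative f (at (g y)) v)" for v
      using Ck_on_compose[OF A(1) assms(1) gS Suc] smooth_on_frechet_derivative[OF assms(2)]
      unfolding smooth_on_def by blast
    then have "Ck_on k A (\<lambda>y. inv_into UNIV (frechet_derivative f (at (g y))) v)" for v
      using lin bij f' gS by (intro Ck_on_inv_linear[OF A(1)]) (auto simp: image_subset_iff)
    then show ?case
      using g g' f' gS by (intro Ck_on_SucI[OF A(1)]) (auto simp: image_subset_iff)
  qed
  then show ?thesis using that N A hom by (simp add: smooth_on_def)
qed

section \<open>Local actions in a chart around the identity\<close>

text \<open>As a filter statement, finitely many local conditions can be intersected without naming
  neighbourhoods. In the converse, taking the union of all good open sets replaces a choice of one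
  for each point.\<close>

lemma near_identity_iff_eventually:
  "near_identity e S P \<longleftrightarrow> (\<forall>\<xi>\<in>S. \<forall>\<^sub>F z in nhds (e, \<xi>). snd z \<in> S \<longrightarrow> P (fst z) (snd z))"
proof
  assume "near_identity e S P"
  then show "\<forall>\<xi>\<in>S. \<forall>\<^sub>F z in nhds (e, \<xi>). snd z \<in> S \<longrightarrow> P (fst z) (snd z)"
    unfolding near_identity_def eventually_nhds by fastforce
next
  assume *: "\<forall>\<xi>\<in>S. \<forall>\<^sub>F z in nhds (e, \<xi>). snd z \<in> S \<longrightarrow> P (fst z) (snd z)"
  define \<Omega> where "\<Omega> = \<Union>{T. open T \<and> (\<forall>z\<in>T. snd z \<in> S \<longrightarrow> P (fst z) (snd z))}"
  have "open \<Omega>" unfolding \<Omega>_def by blast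
  moreover have "{e} \<times> S \<subseteq> \<Omega>" using * unfolding eventually_nhds \<Omega>_def by blast
  moreover have "\<forall>(g, \<xi>)\<in>\<Omega>. \<xi> \<in> S \<longrightarrow> P g \<xi>" unfolding \<Omega>_def by fastforce
  ultimately show "near_identity e S P" unfolding near_identity_def by blast
qed

text \<open>Intended for group elements that vary with the point, such as \<open>inv (a x)\<close>
  for \<open>x\<close> tending to \<open>x0\<close>: convergence to the identity is all that has to
  be checked.\<close>

lemma near_identity_eventually:
  assumes "near_identity e S P" "\<xi> \<in> S" "(a \<longlongrightarrow> e) F" "(x \<longlongrightarrow> \<xi>) F"
  shows "\<forall>\<^sub>F z in F. x z \<in> S \<longrightarrow> P (a z) (x z)"
proof -
  have "filterlim (\<lambda>z. (a z, x z)) (nhds (e, \<xi>)) F"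
    using tendsto_Pair[OF assms(3,4)] .
  from eventually_compose_filterlim[OF bspec[OF assms(1)[unfolded near_identity_iff_eventually] assms(2)] this]
  show ?thesis by simp
qed

text \<open>Smoothness in the group is only tested near the identity, so one chart is fixed once and
  for all; a group-valued map \<open>a\<close> counts as smooth when \<open>c (a z)\<close> is
  smooth in \<open>z\<close>.\<close>

locale charted_lie_group = lie_group G \<A>
  for G :: "'g::{t2_space, second_countable_topology} monoid" (structure)
    and \<A> :: "('g set \<times> ('g \<Rightarrow> real^'r)) set" +
  fixes V :: "'g set" and c :: "'g \<Rightarrow> real^'r"
  assumes chart_in_atlas: "(V, c) \<in> \<A>" and one_in_chart: "\<one> \<in> V"
begin

lemma in_carrier [simp]: "g \<in> carrier G"
  by (simp add: carrier_UNIV)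

lemma chart_V: "open V" "open (c ` V)" "homeomorphism V (c ` V) c (inv_into V c)"
  using atlas chart_in_atlas unfolding smooth_atlas_def chart_def by auto

lemma chart_inverse: "g \<in> V \<Longrightarrow> inv_into V c (c g) = g"
  and inverse_chart: "s \<in> c ` V \<Longrightarrow> c (inv_into V c s) = s"
  and inverse_chart_in: "s \<in> c ` V \<Longrightarrow> inv_into V c s \<in> V"
  using chart_V(3) by (auto simp: homeomorphism_def)

lemma eventually_chart: "(a \<longlongrightarrow> g) F \<Longrightarrow> g \<in> V \<Longrightarrow> \<forall>\<^sub>F z in F. a z \<in> V"
  using topological_tendstoD[OF _ chart_V(1)] .

lemma tendsto_chart: "(a \<longlongrightarrow> g) F \<Longrightarrow> g \<in> V \<Longrightarrow> ((\<lambda>z. c (a z)) \<longlongrightarrow> c g) F"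
  using chart_V(3) eventually_chart unfolding homeomorphism_def
  by (intro continuous_on_tendsto_compose[of V c]) auto

lemma tendsto_mult_group:
  "(a \<longlongrightarrow> g) F \<Longrightarrow> (b \<longlongrightarrow> h) F \<Longrightarrow> ((\<lambda>z. a z \<otimes> b z) \<longlongrightarrow> g \<otimes> h) F"
  using continuous_on_tendsto_compose[OF mult_continuous tendsto_Pair] by fastforce

lemma tendsto_inv_group: "(a \<longlongrightarrow> g) F \<Longrightarrow> ((\<lambda>z. inv (a z)) \<longlongrightarrow> inv g) F"
  using continuous_on_tendsto_compose[OF inverse_continuous] by fastforce

lemma smooth_on_inv:
  assumes "open S" "smooth_on S (\<lambda>z. c (a z))" "\<And>z. z \<in> S \<Longrightarrow> a z \<in> V" "\<And>z. z \<in> S \<Longrightarrow> inv (a z) \<in> V"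
  shows "smooth_on S (\<lambda>z. c (inv (a z)))"
proof -
  have "{s. s \<in> c ` V \<and> inv (inv_into V c s) \<in> V} = c ` V \<inter> (\<lambda>s. inv (inv_into V c s)) -` V"
    by auto
  moreover have "continuous_on (c ` V) (\<lambda>s. inv (inv_into V c s))"
    using chart_V(3) unfolding homeomorphism_def
    by (intro continuous_on_compose2[OF inverse_continuous]) auto
  ultimately have "open {s. s \<in> c ` V \<and> inv (inv_into V c s) \<in> V}"
    using chart_V(1,2) by (simp add: continuous_open_preimage)
  then have "smooth_on S (\<lambda>z. c (inv (inv_into V c (c (a z)))))"
    using assms by (intro smooth_on_compose[OF inverse_smooth[OF chart_in_atlas chart_in_atlas]])
      (auto simp: chart_inverse)
  then show ?thesis
    using assms(3) chart_inverse by (auto intro: smooth_on_cong[OF assms(1), rotated])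
qed

end

section \<open>Smoothness and derivatives of an action in the fixed chart\<close>

locale charted_action = charted_lie_group G \<A> V c
  for G :: "'g::{t2_space, second_countable_topology} monoid" (structure)
    and \<A> :: "('g set \<times> ('g \<Rightarrow> real^'r)) set" and V c +
  fixes \<Sigma> :: "'a::euclidean_space set" and D :: "('g \<times> 'a) set" and \<phi> :: "'g \<Rightarrow> 'a \<Rightarrow> 'a"
  assumes action: "local_transformation_group G \<A> \<Sigma> D \<phi>"
begin

lemma open_D: "open D" and D_subset: "(g, \<xi>) \<in> D \<Longrightarrow> \<xi> \<in> \<Sigma>" and act_in: "(g, \<xi>) \<in> D \<Longrightarrow> \<phi> g \<xi> \<in> \<Sigma>"
  and one_D: "\<xi> \<in> \<Sigma> \<Longrightarrow> (\<one>, \<xi>) \<in> D" and act_one: "\<xi> \<in> \<Sigma> \<Longrightarrow> \<phi> \<one> \<xi> = \<xi>"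
  and act_act: "(g1, \<xi>) \<in> D \<Longrightarrow> (g2, \<phi> g1 \<xi>) \<in> D \<Longrightarrow> (g2 \<otimes> g1, \<xi>) \<in> D \<Longrightarrow> \<phi> g2 (\<phi> g1 \<xi>) = \<phi> (g2 \<otimes> g1) \<xi>"
  using action unfolding local_transformation_group_def by auto

lemma open_\<Sigma>: "open \<Sigma>"
proof -
  have "\<Sigma> = Pair \<one> -` D" using one_D D_subset by auto
  moreover have "open (Pair \<one> -` D)" by (intro open_vimage open_D continuous_intros)
  ultimately show ?thesis by simp
qed

lemma act_inv_act: "(g, \<xi>) \<in> D \<Longrightarrow> (inv g, \<phi> g \<xi>) \<in> D \<Longrightarrow> \<phi> (inv g) (\<phi> g \<xi>) = \<xi>"
  using act_act[of g \<xi> "inv g"] one_D act_one D_subset by simp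

definition chart_dom :: "((real^'r) \<times> 'a) set" where
  "chart_dom = {(s, \<xi>). s \<in> c ` V \<and> (inv_into V c s, \<xi>) \<in> D}"

lemma chart_dom_iff: "g \<in> V \<Longrightarrow> (c g, \<xi>) \<in> chart_dom \<longleftrightarrow> (g, \<xi>) \<in> D"
  by (simp add: chart_dom_def chart_inverse)

lemma open_chart_dom: "open chart_dom"
proof -
  have "chart_dom = c ` V \<times> UNIV \<inter> (\<lambda>(s, \<xi>). (inv_into V c s, \<xi>)) -` D"
    unfolding chart_dom_def by auto
  moreover have "continuous_on (c ` V \<times> (UNIV :: 'a set)) (\<lambda>(s, \<xi>). (inv_into V c s, \<xi>))"
  proof -
    have "continuous_on (c ` V) (inv_into V c)"
      using chart_V(3) by (simp add: homeomorphism_def)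
    then have "continuous_on (c ` V \<times> (UNIV :: 'a set)) (\<lambda>z. inv_into V c (fst z))"
      by (rule continuous_on_compose2) (auto intro: continuous_on_fst continuous_on_id)
    then show ?thesis
      unfolding split_def by (intro continuous_on_Pair continuous_on_snd continuous_on_id)
  qed
  ultimately show ?thesis
    using chart_V(2) open_D by (simp add: continuous_open_preimage open_Times)
qed

lemma smooth_chart_action: "smooth_on chart_dom (\<lambda>(s, \<xi>). \<phi> (inv_into V c s) \<xi>)"
  using action chart_in_atlas unfolding local_transformation_group_def chart_dom_def by fastforce

lemma eventually_D: "(a \<longlongrightarrow> g) F \<Longrightarrow> (x \<longlongrightarrow> \<xi>) F \<Longrightarrow> (g, \<xi>) \<in> D \<Longrightarrow> \<forall>\<^sub>F z in F. (a z, x z) \<in> D"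
  using topological_tendstoD[OF tendsto_Pair open_D] .

lemma tendsto_act:
  assumes "(a \<longlongrightarrow> g) F" "(x \<longlongrightarrow> \<xi>) F" "(g, \<xi>) \<in> D" "g \<in> V"
  shows "((\<lambda>z. \<phi> (a z) (x z)) \<longlongrightarrow> \<phi> g \<xi>) F"
proof -
  have lim: "((\<lambda>z. (c (a z), x z)) \<longlongrightarrow> (c g, \<xi>)) F"
    using tendsto_Pair[OF tendsto_chart[OF assms(1,4)] assms(2)] .
  have mem: "(c g, \<xi>) \<in> chart_dom"
    using assms(3,4) by (simp add: chart_dom_iff)
  have "((\<lambda>z. \<phi> (inv_into V c (c (a z))) (x z)) \<longlongrightarrow> \<phi> (inv_into V c (c g)) \<xi>) F"
    using continuous_on_tendsto_compose[OF smooth_on_continuous[OF smooth_chart_action] lim mem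
        topological_tendstoD[OF lim open_chart_dom mem]] by simp
  moreover have "\<forall>\<^sub>F z in F. \<phi> (inv_into V c (c (a z))) (x z) = \<phi> (a z) (x z)"
    using eventually_chart[OF assms(1,4)] by eventually_elim (simp add: chart_inverse)
  ultimately show ?thesis
    using assms(4) by (simp add: chart_inverse tendsto_cong)
qed

lemma smooth_on_act:
  fixes x :: "'b::real_normed_vector \<Rightarrow> 'a"
  assumes "open S" "smooth_on S (\<lambda>z. c (a z))" "smooth_on S x"
    and "\<And>z. z \<in> S \<Longrightarrow> a z \<in> V" "\<And>z. z \<in> S \<Longrightarrow> (a z, x z) \<in> D"
  shows "smooth_on S (\<lambda>z. \<phi> (a z) (x z))"
proof -
  have "smooth_on S (\<lambda>z. \<phi> (inv_into V c (c (a z))) (x z))"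
    by (rule smooth_on_compose2[OF smooth_chart_action assms(1) open_chart_dom assms(2,3)])
      (simp add: chart_dom_iff assms)
  then show ?thesis
    using assms(4) chart_inverse by (auto intro: smooth_on_cong[OF assms(1), rotated])
qed

text \<open>The derivative of a single \<open>\<phi> g\<close> is the joint derivative in group
  coordinates and point, restricted to directions with zero group component. In this form it depends
  smoothly on \<open>g\<close> and \<open>\<xi>\<close> together.\<close>

lemma has_derivative_act:
  assumes "(g, \<xi>) \<in> D" "g \<in> V"
  shows "(\<phi> g has_derivative
      (\<lambda>v. frechet_derivative (\<lambda>(s, \<xi>). \<phi> (inv_into V c s) \<xi>) (at (c g, \<xi>)) (0, v))) (at \<xi>)"
proof -
  have "((\<lambda>\<xi>. (c g, \<xi>)) has_derivative (\<lambda>v. (0, v))) (at \<xi>)"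
    by (auto intro!: derivative_eq_intros)
  from has_derivative_compose[OF this smooth_on_has_derivative[OF smooth_chart_action]]
  show ?thesis
    using assms by (simp add: chart_dom_iff chart_inverse)
qed

lemma has_frechet_derivative_act:
  "(g, \<xi>) \<in> D \<Longrightarrow> g \<in> V \<Longrightarrow> (\<phi> g has_derivative frechet_derivative (\<phi> g) (at \<xi>)) (at \<xi>)"
  using has_derivative_act frechet_derivative_at by metis

lemma linear_act_derivative: "(g, \<xi>) \<in> D \<Longrightarrow> g \<in> V \<Longrightarrow> linear (frechet_derivative (\<phi> g) (at \<xi>))"
  using has_frechet_derivative_act has_derivative_linear by blast

lemma smooth_on_act_derivative:
  fixes x :: "'b::real_normed_vector \<Rightarrow> 'a"
  assumes "open S" "smooth_on S (\<lambda>z. c (a z))" "smooth_on S x"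
    and "\<And>z. z \<in> S \<Longrightarrow> a z \<in> V" "\<And>z. z \<in> S \<Longrightarrow> (a z, x z) \<in> D"
  shows "smooth_on S (\<lambda>z. frechet_derivative (\<phi> (a z)) (at (x z)) v)"
proof -
  have "smooth_on S (\<lambda>z. frechet_derivative (\<lambda>(s, \<xi>). \<phi> (inv_into V c s) \<xi>) (at (c (a z), x z)) (0, v))"
    by (rule smooth_on_compose[OF smooth_on_frechet_derivative[OF smooth_chart_action] assms(1) open_chart_dom])
      (simp_all add: smooth_on_Pair chart_dom_iff assms)
  moreover have "frechet_derivative (\<lambda>(s, \<xi>). \<phi> (inv_into V c s) \<xi>) (at (c (a z), x z)) (0, v) =
      frechet_derivative (\<phi> (a z)) (at (x z)) v" if "z \<in> S" for z
    using frechet_derivative_at[OF has_derivative_act] assms(4,5)[OF that] by metis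
  ultimately show ?thesis by (rule smooth_on_cong[OF assms(1), rotated])
qed

text \<open>The three domain conditions are open, so the composition law holds on a neighbourhood of
  \<open>\<xi>\<close> and can be differentiated there. The product \<open>g2 \<otimes> g1\<close>
  may leave \<open>V\<close>; its differentiability is inherited from the composite.\<close>

lemma act_derivative_compose:
  assumes "(g1, \<xi>) \<in> D" "(g2, \<phi> g1 \<xi>) \<in> D" "(g2 \<otimes> g1, \<xi>) \<in> D" "g1 \<in> V" "g2 \<in> V"
  shows "frechet_derivative (\<phi> (g2 \<otimes> g1)) (at \<xi>) v =
    frechet_derivative (\<phi> g2) (at (\<phi> g1 \<xi>)) (frechet_derivative (\<phi> g1) (at \<xi>) v)"
proof -
  have lim: "((\<lambda>\<eta>. \<phi> g1 \<eta>) \<longlongrightarrow> \<phi> g1 \<xi>) (nhds \<xi>)"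
    by (rule tendsto_act) (use assms in \<open>auto intro: filterlim_ident\<close>)
  have "\<forall>\<^sub>F \<eta> in nhds \<xi>. (g1, \<eta>) \<in> D" "\<forall>\<^sub>F \<eta> in nhds \<xi>. (g2 \<otimes> g1, \<eta>) \<in> D"
    "\<forall>\<^sub>F \<eta> in nhds \<xi>. (g2, \<phi> g1 \<eta>) \<in> D"
    by (rule eventually_D[OF tendsto_const filterlim_ident assms(1)]
        eventually_D[OF tendsto_const filterlim_ident assms(3)] eventually_D[OF tendsto_const lim assms(2)])+
  then have ev: "\<forall>\<^sub>F \<eta> in nhds \<xi>. \<phi> g2 (\<phi> g1 \<eta>) = \<phi> (g2 \<otimes> g1) \<eta>"
    by eventually_elim (rule act_act)
  have "((\<lambda>\<eta>. \<phi> g2 (\<phi> g1 \<eta>)) has_derivative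
      (\<lambda>v. frechet_derivative (\<phi> g2) (at (\<phi> g1 \<xi>)) (frechet_derivative (\<phi> g1) (at \<xi>) v))) (at \<xi>)"
    using has_derivative_compose[OF has_frechet_derivative_act[OF assms(1,4)] has_frechet_derivative_act[OF assms(2,5)]] .
  then have "(\<phi> (g2 \<otimes> g1) has_derivative
      (\<lambda>v. frechet_derivative (\<phi> g2) (at (\<phi> g1 \<xi>)) (frechet_derivative (\<phi> g1) (at \<xi>) v))) (at \<xi>)"
  proof (rule has_derivative_transform_eventually)
    show "\<forall>\<^sub>F \<eta> in at \<xi>. \<phi> g2 (\<phi> g1 \<eta>) = \<phi> (g2 \<otimes> g1) \<eta>"
      using ev unfolding eventually_at_filter by (rule eventually_mono) simp
  qed (use eventually_nhds_x_imp_x[OF ev] in simp_all)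
  from fun_cong[OF frechet_derivative_at[OF this], of v] show ?thesis by simp
qed

lemma act_derivative_one:
  assumes "\<xi> \<in> \<Sigma>"
  shows "frechet_derivative (\<phi> \<one>) (at \<xi>) v = v"
proof -
  have "(\<phi> \<one> has_derivative (\<lambda>v. v)) (at \<xi>)"
    by (rule has_derivative_transform_within_open[OF has_derivative_ident open_\<Sigma> assms]) (simp add: act_one)
  from fun_cong[OF frechet_derivative_at[OF this], of v] show ?thesis by simp
qed

lemma act_derivative_inv:
  assumes "(g, \<xi>) \<in> D" "(inv g, \<phi> g \<xi>) \<in> D" "g \<in> V" "inv g \<in> V"
  shows "frechet_derivative (\<phi> (inv g)) (at (\<phi> g \<xi>)) (frechet_derivative (\<phi> g) (at \<xi>) v) = v"
proof -
  have \<xi>: "\<xi> \<in> \<Sigma>" using D_subset assms by blast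
  show ?thesis
    using act_derivative_one[OF \<xi>] act_derivative_compose[of g \<xi> "inv g" v] assms one_D[OF \<xi>] by simp
qed

end

section \<open>Moving frames\<close>

lemma inj_linear_iff_dim_range:
  fixes M :: "real^'m \<Rightarrow> real^'n"
  assumes "linear M"
  shows "inj M \<longleftrightarrow> dim (range M) = CARD('m)"
proof -
  have "M = (*v) (matrix M)"
    using assms by (simp add: matrix_works fun_eq_iff)
  then show ?thesis
    using full_rank_injective[of "matrix M"] rank_dim_range[of "matrix M"] by simp
qed

text \<open>The range of \<open>M\<close> and the kernel of its left inverse are complementary.
  Below they become the orbit direction and the direction of the cross-section.\<close>

lemma dim_kernel_left_inverse:
  fixes M :: "'a::euclidean_space \<Rightarrow> 'b::euclidean_space"
  assumes "linear M" "linear M'" "\<And>w. M' (M w) = w"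
  shows "dim {z. M' z = 0} + DIM('a) = DIM('b)"
proof -
  have inj: "inj M" using assms(3) by (metis injI)
  have ker: "subspace {z. M' z = 0}" by (rule linear_subspace_kernel[OF assms(2)])
  have "dim {x + y |x y. x \<in> range M \<and> y \<in> {z. M' z = 0}} + dim (range M \<inter> {z. M' z = 0}) =
      dim (range M) + dim {z. M' z = 0}"
    by (rule dim_sums_Int[OF linear_subspace_image[OF assms(1) subspace_UNIV] ker])
  moreover have "v \<in> {x + y |x y. x \<in> range M \<and> y \<in> {z. M' z = 0}}" for v
  proof -
    have "M' (v - M (M' v)) = 0"
      using assms(3) by (simp add: linear_diff[OF assms(2)])
    moreover have "v = M (M' v) + (v - M (M' v))" by simp
    ultimately show ?thesis by blast
  qed
  then have "{x + y |x y. x \<in> range M \<and> y \<in> {z. M' z = 0}} = UNIV" by blast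
  moreover have "range M \<inter> {z. M' z = 0} = {0}"
    using assms(3) linear_0[OF assms(1)] linear_0[OF assms(2)] by (auto simp: image_iff)
  moreover have "dim (range M) = DIM('a)"
    using dim_image_eq[OF assms(1), of UNIV] inj by (simp add: inj_on_def)
  ultimately show ?thesis by simp
qed

text \<open>The cross-section is \<open>x0 + K\<close>, and \<open>a x\<close>,
  \<open>\<zeta> x\<close> are the group and section components of \<open>x\<close>.
  \<open>frame_equivariant\<close> moves the point by a small group element.
  \<open>frame_section\<close> instead freezes \<open>a x\<close> and moves the section point; it
  supplies the local right inverse behind the rank of the invariant.\<close>

locale moving_frame = charted_action G \<A> V c X D \<phi>
  for G :: "'g::{t2_space, second_countable_topology} monoid" (structure)
    and \<A> :: "('g set \<times> ('g \<Rightarrow> real^'r)) set" and V c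
    and X :: "(real^'n) set" and D and \<phi> +
  fixes A :: "(real^'n) set" and a :: "real^'n \<Rightarrow> 'g" and \<zeta> :: "real^'n \<Rightarrow> real^'n"
    and K :: "(real^'n) set" and x0 :: "real^'n"
  assumes open_A: "open A" and x0_in: "x0 \<in> A" and A_subset: "A \<subseteq> X"
    and subspace_K: "subspace K" and dim_K: "dim K + CARD('r) = CARD('n)"
    and frame_base: "a x0 = \<one>" "\<zeta> x0 = x0"
    and frame_in: "\<And>x. x \<in> A \<Longrightarrow> a x \<in> V" "\<And>x. x \<in> A \<Longrightarrow> inv (a x) \<in> V"
      "\<And>x. x \<in> A \<Longrightarrow> (a x, \<zeta> x) \<in> D" "\<And>x. x \<in> A \<Longrightarrow> (inv (a x), x) \<in> D"
      "\<And>x. x \<in> A \<Longrightarrow> \<zeta> x - x0 \<in> K"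
    and frame_act: "\<And>x. x \<in> A \<Longrightarrow> \<phi> (a x) (\<zeta> x) = x"
    and frame_smooth: "smooth_on A (\<lambda>x. c (a x))" "smooth_on A \<zeta>"
    and frame_continuous: "continuous_on A a"
    and frame_equivariant: "\<And>x. x \<in> A \<Longrightarrow> \<forall>\<^sub>F z in nhds (\<one>, x).
        \<phi> (fst z) (snd z) \<in> A \<and> a (\<phi> (fst z) (snd z)) = fst z \<otimes> a (snd z) \<and>
        \<zeta> (\<phi> (fst z) (snd z)) = \<zeta> (snd z)"
    and frame_section: "\<And>x. x \<in> A \<Longrightarrow> \<forall>\<^sub>F \<zeta>' in nhds (\<zeta> x). \<zeta>' - x0 \<in> K \<longrightarrow>
        \<phi> (a x) \<zeta>' \<in> A \<and> a (\<phi> (a x) \<zeta>') = a x \<and> \<zeta> (\<phi> (a x) \<zeta>') = \<zeta>'"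

lemma moving_frame_exists:
  fixes G :: "'g::{t2_space, second_countable_topology} monoid" (structure)
    and \<A> :: "('g set \<times> ('g \<Rightarrow> real^'r)) set" and X :: "(real^'n) set"
  assumes "charted_action G \<A> V c X D \<phi>" and rank: "full_rank_action \<A> D \<phi>" and x0: "x0 \<in> X"
  shows "\<exists>A a \<zeta> K. moving_frame G \<A> V c X D \<phi> A a \<zeta> K x0"
proof -
  interpret charted_action G \<A> V c X D \<phi> by fact
  define s0 where "s0 = c \<one>"
  define \<Phi> where "\<Phi> z = \<phi> (inv_into V c (fst z)) (snd z)" for z
  define d\<Phi> where "d\<Phi> = frechet_derivative \<Phi> (at (s0, x0))"
  \<comment> \<open>The derivative at the identity of the orbit map through \<open>x0\<close>; the
    full-rank assumption makes it injective.\<close>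
  define M where "M w = d\<Phi> (w, 0)" for w
  have \<Phi>_smooth: "smooth_on chart_dom \<Phi>"
    using smooth_chart_action by (simp add: \<Phi>_def[abs_def] split_def)
  have base: "(s0, x0) \<in> chart_dom"
    by (simp add: s0_def chart_dom_iff one_in_chart one_D x0)
  have d\<Phi>: "(\<Phi> has_derivative d\<Phi>) (at (s0, x0))"
    unfolding d\<Phi>_def by (rule smooth_on_has_derivative[OF \<Phi>_smooth base])
  then have lin: "linear d\<Phi>" by (rule has_derivative_linear)
  have M: "linear M"
    unfolding M_def by (rule linear_compose[OF _ lin, unfolded o_def]) (auto intro!: linearI)
  have "((\<lambda>s. (s, x0)) has_derivative (\<lambda>w. (w, 0))) (at s0)"
    by (auto intro!: derivative_eq_intros)
  from has_derivative_compose[OF this d\<Phi>]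
  have "((\<lambda>s. \<phi> (inv_into V c s) x0) has_derivative M) (at (c \<one>))"
    by (simp add: \<Phi>_def M_def[abs_def] s0_def)
  from frechet_derivative_at[OF this]
  have "derivative_rank (\<lambda>s. \<phi> (inv_into V c s) x0) (c \<one>) = dim (range M)"
    by (simp add: derivative_rank_def)
  moreover have "derivative_rank (\<lambda>s. \<phi> (inv_into V c s) x0) (c \<one>) = CARD('r)"
    using rank one_D[OF x0] chart_in_atlas one_in_chart unfolding full_rank_action_def by fast
  ultimately have "inj M"
    using inj_linear_iff_dim_range[OF M] by simp
  then obtain M' where M': "linear M'" "M' \<circ> M = id"
    using linear_injective_left_inverse[OF M] by blast
  have M'M: "M' (M w) = w" for w
    using M'(2) by (simp add: pointfree_idE)
  define K where "K = {z. M' z = 0}"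
  have K: "subspace K" "dim K + CARD('r) = CARD('n)"
    using linear_subspace_kernel[OF M'(1)] dim_kernel_left_inverse[OF M M'(1) M'M] by (simp_all add: K_def)
  have proj_K: "v - M (M' v) \<in> K" for v
    by (simp add: K_def linear_diff[OF M'(1)] M'M)
  define \<sigma> where "\<sigma> v = s0 + M' v" for v
  define \<pi> where "\<pi> v = x0 + (v - M (M' v))" for v
  have \<sigma>\<pi>_base: "\<sigma> 0 = s0" "\<pi> 0 = x0"
    by (simp_all add: \<sigma>_def \<pi>_def linear_0[OF M] linear_0[OF M'(1)])
  have smooth_\<sigma>: "smooth_on S \<sigma>" and smooth_\<pi>: "smooth_on S \<pi>" if "open S" for S
    unfolding \<sigma>_def \<pi>_def
    using smooth_on_linear[OF that M'(1)] smooth_on_linear[OF that linear_compose[OF M'(1) M]]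
    by (auto intro!: smooth_on_add smooth_on_diff smooth_on_const smooth_on_ident that simp: o_def)
  define S where "S = (\<lambda>v. (\<sigma> v, \<pi> v)) -` chart_dom"
  have S: "open S"
    unfolding S_def
    by (intro open_vimage open_chart_dom continuous_on_Pair smooth_on_continuous smooth_\<sigma> smooth_\<pi> open_UNIV)
  have S0: "0 \<in> S" using base by (simp add: S_def \<sigma>\<pi>_base)
  define \<Gamma> where "\<Gamma> v = \<Phi> (\<sigma> v, \<pi> v)" for v
  \<comment> \<open>As \<open>M \<circ> M'\<close> and its complement split the space into the orbit direction and the cross-section,
     \<open>\<Gamma>\<close> has the identity as derivative at \<open>0\<close>; working on the whole space avoids a type of dimension \<open>n - r\<close>.\<close>
  have \<Gamma>_smooth: "smooth_on S \<Gamma>"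
    unfolding \<Gamma>_def[abs_def]
    by (rule smooth_on_compose[OF \<Phi>_smooth S open_chart_dom])
      (intro smooth_on_Pair smooth_\<sigma> smooth_\<pi> S, simp add: S_def)
  have "d\<Phi> (0, v) = v" for v
  proof -
    have "(\<lambda>(s, \<xi>). \<phi> (inv_into V c s) \<xi>) = \<Phi>" by (simp add: \<Phi>_def fun_eq_iff)
    with has_derivative_act[OF one_D[OF x0] one_in_chart]
    have "(\<phi> \<one> has_derivative (\<lambda>v. d\<Phi> (0, v))) (at x0)" by (simp add: d\<Phi>_def s0_def)
    from fun_cong[OF frechet_derivative_at[OF this]] show ?thesis
      by (simp add: act_derivative_one[OF x0])
  qed
  then have d\<Phi>_split: "d\<Phi> (w, v) = M w + v" for w v
    using linear_add[OF lin, of "(w, 0)" "(0, v)"] by (simp add: M_def)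
  have "((\<lambda>v. (\<sigma> v, \<pi> v)) has_derivative (\<lambda>v. (M' v, v - M (M' v)))) (at 0)"
    unfolding \<sigma>_def \<pi>_def
    using linear_imp_has_derivative[OF M'(1)] linear_imp_has_derivative[OF linear_compose[OF M'(1) M]]
    by (auto intro!: derivative_eq_intros simp: o_def)
  from has_derivative_compose[OF this, of \<Phi> d\<Phi>] d\<Phi>
  have "((\<lambda>v. \<Phi> (\<sigma> v, \<pi> v)) has_derivative (\<lambda>v. d\<Phi> (M' v, v - M (M' v)))) (at 0)"
    by (simp add: \<sigma>\<pi>_base)
  then have "(\<Gamma> has_derivative (\<lambda>v. v)) (at 0)"
    by (simp add: \<Gamma>_def[abs_def] d\<Phi>_split)
  from frechet_derivative_at[OF this] have "inj (frechet_derivative \<Gamma> (at 0))"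
    by (metis injI)
  then obtain N A0 \<beta> where N: "open N" "N \<subseteq> S" "0 \<in> N" and A0: "open A0" "\<Gamma> 0 \<in> A0"
    and hom: "homeomorphism N A0 \<Gamma> \<beta>" and \<beta>_smooth: "smooth_on A0 \<beta>"
    using smooth_inverse_function[OF S \<Gamma>_smooth S0] by blast
  have \<beta>\<Gamma>: "\<beta> (\<Gamma> v) = v" "\<Gamma> v \<in> A0" if "v \<in> N" for v
    using hom that by (auto simp: homeomorphism_def)
  have \<Gamma>\<beta>: "\<Gamma> (\<beta> x) = x" "\<beta> x \<in> N" if "x \<in> A0" for x
    using hom that by (auto simp: homeomorphism_def)
  have \<Gamma>0: "\<Gamma> 0 = x0"
    by (simp add: \<Gamma>_def \<sigma>\<pi>_base \<Phi>_def s0_def chart_inverse one_in_chart act_one x0)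
  define a where "a x = inv_into V c (\<sigma> (\<beta> x))" for x
  define \<zeta> where "\<zeta> x = \<pi> (\<beta> x)" for x
  have in_S: "\<sigma> (\<beta> x) \<in> c ` V" "(a x, \<zeta> x) \<in> D" if "x \<in> A0" for x
    using \<Gamma>\<beta>(2)[OF that] N(2) by (auto simp: S_def chart_dom_def a_def \<zeta>_def)
  have a_in: "a x \<in> V" "c (a x) = \<sigma> (\<beta> x)" if "x \<in> A0" for x
    using in_S(1)[OF that] inverse_chart_in inverse_chart by (auto simp: a_def)
  have act_a: "\<phi> (a x) (\<zeta> x) = x" if "x \<in> A0" for x
    using \<Gamma>\<beta>(1)[OF that] by (simp add: \<Gamma>_def \<Phi>_def a_def \<zeta>_def)
  have \<zeta>_K: "\<zeta> x - x0 \<in> K" for x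
    by (simp add: \<zeta>_def \<pi>_def proj_K)
  have a_smooth: "smooth_on A0 (\<lambda>x. c (a x))"
    by (rule smooth_on_cong[OF A0(1) _ smooth_on_compose[OF smooth_\<sigma>[OF open_UNIV] A0(1) open_UNIV \<beta>_smooth]])
      (auto simp: a_in)
  have \<zeta>_smooth: "smooth_on A0 \<zeta>"
    unfolding \<zeta>_def[abs_def]
    by (rule smooth_on_compose[OF smooth_\<pi>[OF open_UNIV] A0(1) open_UNIV \<beta>_smooth]) simp
  have a_cont: "continuous_on A0 a"
  proof -
    have "continuous_on A0 (\<lambda>x. inv_into V c (\<sigma> (\<beta> x)))"
    proof (rule continuous_on_compose2[of "c ` V" "inv_into V c" A0 "\<lambda>x. \<sigma> (\<beta> x)"])
      show "continuous_on (c ` V) (inv_into V c)" using chart_V(3) by (simp add: homeomorphism_def)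
      show "continuous_on A0 (\<lambda>x. \<sigma> (\<beta> x))"
        using smooth_on_continuous[OF a_smooth] by (simp add: a_in cong: continuous_on_cong)
      show "(\<lambda>x. \<sigma> (\<beta> x)) ` A0 \<subseteq> c ` V" using in_S(1) by blast
    qed
    then show ?thesis by (simp add: a_def[abs_def])
  qed
  have a_tendsto: "((\<lambda>z. a (x z)) \<longlongrightarrow> a x1) F" and \<zeta>_tendsto: "((\<lambda>z. \<zeta> (x z)) \<longlongrightarrow> \<zeta> x1) F"
    if "(x \<longlongrightarrow> x1) F" "x1 \<in> A0" for x :: "'z \<Rightarrow> real^'n" and x1 F
    using continuous_on_tendsto_compose[OF a_cont that topological_tendstoD[OF that(1) A0(1) that(2)]]
      continuous_on_tendsto_compose[OF smooth_on_continuous[OF \<zeta>_smooth] that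
        topological_tendstoD[OF that(1) A0(1) that(2)]] .
  \<comment> \<open>The vector in the third assumption has group coordinate \<open>c g\<close> and
    section point \<open>\<zeta>'\<close>. As \<open>\<beta>\<close> inverts \<open>\<Gamma>\<close>
    on \<open>N\<close>, it recovers exactly this pair from
    \<open>\<phi> g \<zeta>'\<close>.\<close>
  have unique: "(g, \<zeta>') \<in> D \<and> \<phi> g \<zeta>' \<in> A0 \<and> a (\<phi> g \<zeta>') = g \<and> \<zeta> (\<phi> g \<zeta>') = \<zeta>'"
    if "g \<in> V" "\<zeta>' - x0 \<in> K" "M (c g - s0) + (\<zeta>' - x0) \<in> N" for g \<zeta>'
  proof -
    let ?v = "M (c g - s0) + (\<zeta>' - x0)"
    have "M' ?v = c g - s0"
      using that(2) by (simp add: linear_add[OF M'(1)] M'M K_def)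
    then have \<sigma>: "\<sigma> ?v = c g" and \<pi>: "\<pi> ?v = \<zeta>'"
      by (simp_all add: \<sigma>_def \<pi>_def)
    then have "\<Gamma> ?v = \<phi> g \<zeta>'"
      using that(1) by (simp add: \<Gamma>_def \<Phi>_def chart_inverse)
    moreover have "(g, \<zeta>') \<in> D"
      using that(1,3) N(2) \<sigma> \<pi> by (auto simp: S_def chart_dom_iff)
    ultimately show ?thesis
      using \<beta>\<Gamma>[OF that(3)] \<sigma> \<pi> that(1) by (simp add: a_def \<zeta>_def chart_inverse)
  qed
  \<comment> \<open>The components of \<open>x\<close> itself give back the parameter
    \<open>\<beta> x\<close> in the open set \<open>N\<close>. By continuity nearby components also
    give parameters in \<open>N\<close>, which is the premise of \<open>unique\<close>.\<close>
  have reconstruct: "M (c (a x) - s0) + (\<zeta> x - x0) = \<beta> x" if "x \<in> A0" for x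
    using a_in(2)[OF that] by (simp add: \<sigma>_def \<zeta>_def \<pi>_def)
  \<comment> \<open>Shrunk so that moving \<open>x\<close> back to the section by
    \<open>inv (a x)\<close> is legitimate as well; \<open>x0\<close> survives because
    \<open>a x0 = \<one>\<close>.\<close>
  define A where "A = {x \<in> A0. inv (a x) \<in> V \<and> (inv (a x), x) \<in> D}"
  have inv_cont: "continuous_on A0 (\<lambda>x. inv (a x))"
    by (rule continuous_on_compose2[OF inverse_continuous a_cont]) simp
  have "A = A0 \<inter> ((\<lambda>x. (inv (a x), x)) -` (D \<inter> V \<times> UNIV))"
    by (auto simp: A_def)
  moreover have "open (A0 \<inter> ((\<lambda>x. (inv (a x), x)) -` (D \<inter> V \<times> UNIV)))"
    by (intro continuous_open_preimage continuous_on_Pair inv_cont continuous_on_id A0(1) open_Int open_D open_Times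
        chart_V(1) open_UNIV)
  ultimately have A_open: "open A" by simp
  have a0: "a x0 = \<one>" "\<zeta> x0 = x0"
    using \<beta>\<Gamma>(1)[OF N(3)] by (simp_all add: a_def \<zeta>_def \<Gamma>0 \<sigma>\<pi>_base s0_def chart_inverse one_in_chart)
  have A_A0: "x \<in> A0" if "x \<in> A" for x using that by (simp add: A_def)
  show ?thesis
  proof (intro exI, unfold_locales)
    show "open A" by fact
    show "x0 \<in> A" using A0(2) a0 x0 by (simp add: A_def \<Gamma>0 one_in_chart one_D)
    show "A \<subseteq> X" using D_subset by (auto simp: A_def)
    show "subspace K" "dim K + CARD('r) = CARD('n)" by fact+
    show "a x0 = \<one>" "\<zeta> x0 = x0" by fact+
    show "smooth_on A (\<lambda>x. c (a x))" "smooth_on A \<zeta>" "continuous_on A a"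
      using a_smooth \<zeta>_smooth a_cont A_A0 by (auto intro: smooth_on_subset continuous_on_subset)
    fix x assume x: "x \<in> A"
    note xA0 = A_A0[OF x]
    show "a x \<in> V" "inv (a x) \<in> V" "(a x, \<zeta> x) \<in> D" "(inv (a x), x) \<in> D" "\<zeta> x - x0 \<in> K" "\<phi> (a x) (\<zeta> x) = x"
      using x a_in in_S act_a \<zeta>_K by (auto simp: A_def)
    have x_dom: "(\<one>, x) \<in> D"
      using x by (auto simp: A_def intro: one_D D_subset)
    \<comment> \<open>\<open>\<phi> g x = \<phi> (g \<otimes> a x) (\<zeta> x)\<close> is again a
      decomposition over the section, and its group part stays close to \<open>a x\<close>; by
      \<open>unique\<close> it is the decomposition that the frame assigns to
      \<open>\<phi> g x\<close>.\<close>
    show "\<forall>\<^sub>F z in nhds (\<one>, x).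
        \<phi> (fst z) (snd z) \<in> A \<and> a (\<phi> (fst z) (snd z)) = fst z \<otimes> a (snd z) \<and>
        \<zeta> (\<phi> (fst z) (snd z)) = \<zeta> (snd z)"
    proof -
      let ?F = "nhds (\<one>, x)"
      have fst: "(fst \<longlongrightarrow> \<one>) ?F" and snd: "(snd \<longlongrightarrow> x) ?F"
        using tendsto_fst[OF filterlim_ident, of "(\<one>, x)"] tendsto_snd[OF filterlim_ident, of "(\<one>, x)"] by simp_all
      have prod: "((\<lambda>z. fst z \<otimes> a (snd z)) \<longlongrightarrow> a x) ?F"
        using tendsto_mult_group[OF fst a_tendsto[OF snd xA0]] by simp
      have "((\<lambda>z. M (c (fst z \<otimes> a (snd z)) - s0) + (\<zeta> (snd z) - x0)) \<longlongrightarrow> M (c (a x) - s0) + (\<zeta> x - x0)) ?F"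
        by (intro tendsto_add tendsto_diff tendsto_const \<zeta>_tendsto[OF snd xA0] tendsto_chart[OF prod a_in(1)[OF xA0]]
            bounded_linear.tendsto[OF linear_conv_bounded_linear[THEN iffD1, OF M]])
      then have "\<forall>\<^sub>F z in ?F. M (c (fst z \<otimes> a (snd z)) - s0) + (\<zeta> (snd z) - x0) \<in> N"
        by (rule topological_tendstoD) (simp_all add: N(1) reconstruct[OF xA0] \<Gamma>\<beta>(2)[OF xA0])
      moreover have "\<forall>\<^sub>F z in ?F. fst z \<otimes> a (snd z) \<in> V"
        by (rule eventually_chart[OF prod a_in(1)[OF xA0]])
      moreover have "\<forall>\<^sub>F z in ?F. snd z \<in> A"
        by (rule topological_tendstoD[OF snd A_open x])
      moreover have "\<forall>\<^sub>F z in ?F. (fst z, snd z) \<in> D"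
        by (rule eventually_D[OF fst snd x_dom])
      moreover have "\<forall>\<^sub>F z in ?F. \<phi> (fst z) (snd z) \<in> A"
        by (rule topological_tendstoD[OF tendsto_act[OF fst snd x_dom one_in_chart] A_open])
          (use x x_dom D_subset in \<open>auto simp: act_one\<close>)
      ultimately show ?thesis
      proof eventually_elim
        case (elim z)
        note zA0 = A_A0[OF elim(3)]
        from unique[OF elim(2) \<zeta>_K elim(1)] have u: "(fst z \<otimes> a (snd z), \<zeta> (snd z)) \<in> D"
          "a (\<phi> (fst z \<otimes> a (snd z)) (\<zeta> (snd z))) = fst z \<otimes> a (snd z)"
          "\<zeta> (\<phi> (fst z \<otimes> a (snd z)) (\<zeta> (snd z))) = \<zeta> (snd z)" by blast+
        have "\<phi> (fst z) (snd z) = \<phi> (fst z \<otimes> a (snd z)) (\<zeta> (snd z))"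
          using act_act[OF in_S(2)[OF zA0] _ u(1)] act_a[OF zA0] elim(4) by simp
        then show ?case using u elim(5) by simp
      qed
    qed
    show "\<forall>\<^sub>F \<zeta>' in nhds (\<zeta> x). \<zeta>' - x0 \<in> K \<longrightarrow>
        \<phi> (a x) \<zeta>' \<in> A \<and> a (\<phi> (a x) \<zeta>') = a x \<and> \<zeta> (\<phi> (a x) \<zeta>') = \<zeta>'"
    proof -
      let ?F = "nhds (\<zeta> x)"
      have id: "((\<lambda>\<zeta>'. \<zeta>') \<longlongrightarrow> \<zeta> x) ?F" by (rule filterlim_ident)
      have "((\<lambda>\<zeta>'. M (c (a x) - s0) + (\<zeta>' - x0)) \<longlongrightarrow> M (c (a x) - s0) + (\<zeta> x - x0)) ?F"
        by (intro tendsto_add tendsto_diff tendsto_const id)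
      then have "\<forall>\<^sub>F \<zeta>' in ?F. M (c (a x) - s0) + (\<zeta>' - x0) \<in> N"
        by (rule topological_tendstoD) (simp_all add: N(1) reconstruct[OF xA0] \<Gamma>\<beta>(2)[OF xA0])
      moreover have "\<forall>\<^sub>F \<zeta>' in ?F. \<phi> (a x) \<zeta>' \<in> A"
        by (rule topological_tendstoD[OF tendsto_act[OF tendsto_const id in_S(2)[OF xA0] a_in(1)[OF xA0]] A_open])
          (simp add: act_a[OF xA0] x)
      ultimately show ?thesis
        by eventually_elim (use unique[OF a_in(1)[OF xA0]] in blast)
    qed
  qed
qed

section \<open>Invariant frames\<close>

lemma near_identity_subset:
  assumes "near_identity e S P" "T \<subseteq> S"
  shows "near_identity e T P"
proof -
  obtain \<Omega> where "open \<Omega>" "{e} \<times> S \<subseteq> \<Omega>" and P: "\<forall>(g, \<xi>)\<in>\<Omega>. \<xi> \<in> S \<longrightarrow> P g \<xi>"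
    using assms(1) unfolding near_identity_def by blast
  moreover have "{e} \<times> T \<subseteq> \<Omega>" using assms(2) calculation(2) by blast
  moreover have "\<forall>(g, \<xi>)\<in>\<Omega>. \<xi> \<in> T \<longrightarrow> P g \<xi>" using P assms(2) by fast
  ultimately show ?thesis unfolding near_identity_def by blast
qed

text \<open>Serves the empty fibres of \<open>W\<close> in the definition of an invariant output
  error.\<close>

lemma smooth_on_empty: "smooth_on {} f"
proof -
  have "Ck_on k {} g" for k and g :: "'a::real_normed_vector \<Rightarrow> 'b::real_normed_vector"
    by (induction k arbitrary: g) auto
  then show ?thesis by (simp add: smooth_on_def)
qed

text \<open>Differentiating \<open>f (\<sigma> b') = b'\<close> at \<open>b\<close> shows that the
  derivative of \<open>f\<close> at \<open>\<sigma> b\<close> is onto, so its rank is found without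
  computing it.\<close>

lemma derivative_rank_right_inverse:
  fixes f :: "'a::euclidean_space \<Rightarrow> 'b::euclidean_space"
  assumes "f differentiable at (\<sigma> b)" "\<sigma> differentiable at b" "\<forall>\<^sub>F b' in nhds b. f (\<sigma> b') = b'"
  shows "derivative_rank f (\<sigma> b) = DIM('b)"
proof -
  let ?f = "frechet_derivative f (at (\<sigma> b))" and ?\<sigma> = "frechet_derivative \<sigma> (at b)"
  have "((\<lambda>b. f (\<sigma> b)) has_derivative (\<lambda>v. ?f (?\<sigma> v))) (at b)"
    by (rule has_derivative_compose[OF assms(2)[unfolded frechet_derivative_works]
          assms(1)[unfolded frechet_derivative_works]])
  then have "((\<lambda>b. b) has_derivative (\<lambda>v. ?f (?\<sigma> v))) (at b)"
  proof (rule has_derivative_transform_eventually)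
    show "\<forall>\<^sub>F b' in at b. f (\<sigma> b') = b'"
      using assms(3) unfolding eventually_at_filter by (rule eventually_mono) simp
  qed (use eventually_nhds_x_imp_x[OF assms(3)] in simp_all)
  then have "(\<lambda>v. ?f (?\<sigma> v)) = (\<lambda>v. v)"
    by (rule has_derivative_unique[OF _ has_derivative_ident])
  then have "?f (?\<sigma> v) = v" for v by (rule fun_cong)
  then have "range ?f = UNIV" by (rule surjI)
  then show ?thesis by (simp add: derivative_rank_def)
qed

context charted_action
begin

text \<open>Undo the translation, then act by \<open>inv g\<close>. The image is identified with
  \<open>R\<close>, a preimage under continuous maps, which makes its openness visible.\<close>

lemma smoothly_invertible_act_translate:
  assumes S: "open S" and g: "g \<in> V" "inv g \<in> V"
    and dom: "\<And>y. y \<in> S \<Longrightarrow> (g, y) \<in> D" "\<And>y. y \<in> S \<Longrightarrow> (inv g, \<phi> g y) \<in> D"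
  shows "smoothly_invertible_on S (\<lambda>y. \<phi> g y - b)"
proof -
  define T where "T = {y. (inv g, y) \<in> D}"
  have T: "open T"
  proof -
    have "T = (\<lambda>y. (inv g, y)) -` D" by (auto simp: T_def)
    then show ?thesis by (simp, intro open_vimage open_D continuous_intros)
  qed
  have inv_smooth: "smooth_on T (\<phi> (inv g))"
    by (rule smooth_on_act[OF T smooth_on_const smooth_on_ident[OF T] g(2)]) (simp add: T_def)
  define R where "R = {b'. b' + b \<in> T \<inter> \<phi> (inv g) -` S}"
  have "open (T \<inter> \<phi> (inv g) -` S)"
    using continuous_open_preimage[OF smooth_on_continuous[OF inv_smooth] T S] .
  moreover have "R = (\<lambda>b'. b' + b) -` (T \<inter> \<phi> (inv g) -` S)" by (auto simp: R_def)
  ultimately have R: "open R" by (simp only:) (intro open_vimage continuous_intros)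
  have cancel: "\<phi> (inv g) (\<phi> g y) = y" if "y \<in> S" for y
    by (rule act_inv_act[OF dom(1)[OF that] dom(2)[OF that]])
  have img: "(\<lambda>y. \<phi> g y - b) ` S = R"
  proof (intro equalityI subsetI)
    fix b' assume "b' \<in> (\<lambda>y. \<phi> g y - b) ` S"
    then show "b' \<in> R" using dom(2) cancel by (auto simp: R_def T_def)
  next
    fix b' assume "b' \<in> R"
    then have S': "(inv g, b' + b) \<in> D" "\<phi> (inv g) (b' + b) \<in> S" by (auto simp: R_def T_def)
    then have "\<phi> g (\<phi> (inv g) (b' + b)) = b' + b"
      using act_inv_act[OF S'(1)] dom(1)[OF S'(2)] by simp
    then show "b' \<in> (\<lambda>y. \<phi> g y - b) ` S" using S'(2) by (intro image_eqI[of _ _ "\<phi> (inv g) (b' + b)"]) auto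
  qed
  have fwd: "smooth_on S (\<lambda>y. \<phi> g y - b)"
    by (intro smooth_on_diff S smooth_on_const smooth_on_act smooth_on_ident g(1) dom(1))
  have bwd: "smooth_on R (\<lambda>b'. \<phi> (inv g) (b' + b))"
    by (rule smooth_on_compose[OF inv_smooth R T smooth_on_add[OF R smooth_on_ident[OF R] smooth_on_const]])
      (simp add: R_def)
  have "\<forall>y\<in>S. \<phi> (inv g) (\<phi> g y - b + b) = y"
    by (simp add: cancel)
  with fwd bwd R show ?thesis
    unfolding smoothly_invertible_on_def img by blast
qed

end

section \<open>Quantities invariant under normalisation, and the transported frame\<close>

context moving_frame
begin

lemma eventually_A: "(x \<longlongrightarrow> x1) F \<Longrightarrow> x1 \<in> A \<Longrightarrow> \<forall>\<^sub>F z in F. x z \<in> A"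
  using topological_tendstoD[OF _ open_A] .

lemma tendsto_a: "(x \<longlongrightarrow> x1) F \<Longrightarrow> x1 \<in> A \<Longrightarrow> ((\<lambda>z. a (x z)) \<longlongrightarrow> a x1) F"
  using continuous_on_tendsto_compose[OF frame_continuous _ _ eventually_A] .

lemma tendsto_\<zeta>: "(x \<longlongrightarrow> x1) F \<Longrightarrow> x1 \<in> A \<Longrightarrow> ((\<lambda>z. \<zeta> (x z)) \<longlongrightarrow> \<zeta> x1) F"
  using continuous_on_tendsto_compose[OF smooth_on_continuous[OF frame_smooth(2)] _ _ eventually_A] .

lemma act_inv_frame: "x \<in> A \<Longrightarrow> \<phi> (inv (a x)) x = \<zeta> x"
  using act_inv_act[of "a x" "\<zeta> x"] frame_in frame_act by simp

lemma smooth_inv_frame: "smooth_on A (\<lambda>x. c (inv (a x)))"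
  by (rule smooth_on_inv[OF open_A frame_smooth(1) frame_in(1,2)])

lemma eventually_equivariant:
  assumes "x1 \<in> A" "(g \<longlongrightarrow> \<one>) F" "(x \<longlongrightarrow> x1) F"
  shows "\<forall>\<^sub>F z in F. \<phi> (g z) (x z) \<in> A \<and> a (\<phi> (g z) (x z)) = g z \<otimes> a (x z) \<and> \<zeta> (\<phi> (g z) (x z)) = \<zeta> (x z)"
  using eventually_compose_filterlim[OF frame_equivariant[OF assms(1)] tendsto_Pair[OF assms(2,3)]] by simp

text \<open>Equivariance gives \<open>inv (a (\<phi> g x)) = inv (a x) \<otimes> inv g\<close>, and
  the factor \<open>inv g\<close> cancels the \<open>g\<close> acting on \<open>y\<close>. The
  action \<open>\<theta>\<close> is left open because both inputs and outputs are normalised in this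
  way.\<close>

lemma eventually_normalized_invariant:
  assumes "charted_action G \<A> V c \<Sigma>' D' \<theta>"
    and "x1 \<in> A" "(inv (a x1), y1) \<in> D'" "(g \<longlongrightarrow> \<one>) F" "(x \<longlongrightarrow> x1) F" "(y \<longlongrightarrow> y1) F"
  shows "\<forall>\<^sub>F z in F. \<theta> (inv (a (\<phi> (g z) (x z)))) (\<theta> (g z) (y z)) = \<theta> (inv (a (x z))) (y z)"
proof -
  interpret \<theta>: charted_action G \<A> V c \<Sigma>' D' \<theta> by fact
  have y1: "y1 \<in> \<Sigma>'" using \<theta>.D_subset assms(3) by blast
  have inv_a: "((\<lambda>z. inv (a (x z))) \<longlongrightarrow> inv (a x1)) F"
    by (rule tendsto_inv_group[OF tendsto_a[OF assms(5,2)]])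
  have "((\<lambda>z. inv (a (x z)) \<otimes> inv (g z)) \<longlongrightarrow> inv (a x1) \<otimes> inv \<one>) F"
    by (rule tendsto_mult_group[OF inv_a tendsto_inv_group[OF assms(4)]])
  then have lim: "((\<lambda>z. inv (a (x z)) \<otimes> inv (g z)) \<longlongrightarrow> inv (a x1)) F" by simp
  have lim_y: "((\<lambda>z. \<theta> (g z) (y z)) \<longlongrightarrow> y1) F"
    using \<theta>.tendsto_act[OF assms(4,6) \<theta>.one_D[OF y1] one_in_chart] by (simp add: \<theta>.act_one y1)
  show ?thesis
    using eventually_equivariant[OF assms(2,4,5)] \<theta>.eventually_D[OF assms(4,6) \<theta>.one_D[OF y1]]
      \<theta>.eventually_D[OF lim lim_y assms(3)] \<theta>.eventually_D[OF inv_a assms(6,3)]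
  proof eventually_elim
    case (elim z)
    have "inv (a (x z)) \<otimes> inv (g z) \<otimes> g z = inv (a (x z))"
      by (simp add: m_assoc)
    then show ?case
      using elim \<theta>.act_act[OF elim(2,3)] by (simp add: inv_mult_group)
  qed
qed

definition frame_field :: "real^'n \<Rightarrow> real^'n \<Rightarrow> real^'n" where
  "frame_field v x = frechet_derivative (\<phi> (a x)) (at (\<zeta> x)) v"

lemma linear_frame_field: "x \<in> A \<Longrightarrow> linear (\<lambda>v. frame_field v x)"
  unfolding frame_field_def using linear_act_derivative frame_in by blast

lemma frame_field_inverse:
  assumes "x \<in> A"
  shows "frechet_derivative (\<phi> (inv (a x))) (at x) (frame_field v x) = v"
    and "frame_field (frechet_derivative (\<phi> (inv (a x))) (at x) w) x = w"
  using act_derivative_inv[of "a x" "\<zeta> x" v] act_derivative_inv[of "inv (a x)" x w] frame_in[OF assms]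
  by (simp_all add: frame_field_def frame_act act_inv_frame assms)

text \<open>Passing from \<open>x\<close> to \<open>\<phi> g x\<close> turns \<open>a x\<close> into
  \<open>g \<otimes> a x\<close> and leaves \<open>\<zeta> x\<close> alone, so the chain rule
  produces precisely the extra factor \<open>D(\<phi> g)\<close>.\<close>

lemma invariant_frame_field: "invariant_vector_field \<one> \<phi> A (frame_field v)"
  unfolding invariant_vector_field_def
proof
  show "smooth_on A (frame_field v)"
    unfolding frame_field_def[abs_def]
    by (rule smooth_on_act_derivative[OF open_A frame_smooth frame_in(1,3)])
  show "near_identity \<one> A (\<lambda>g x. frame_field v (\<phi> g x) = frechet_derivative (\<phi> g) (at x) (frame_field v x))"
    unfolding near_identity_iff_eventually
  proof
    fix x1 assume x1: "x1 \<in> A"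
    let ?F = "nhds (\<one>, x1)"
    have fst: "(fst \<longlongrightarrow> \<one>) ?F" and snd: "(snd \<longlongrightarrow> x1) ?F"
      using tendsto_fst[OF filterlim_ident, of "(\<one>, x1)"] tendsto_snd[OF filterlim_ident, of "(\<one>, x1)"] by simp_all
    have "((\<lambda>z. fst z \<otimes> a (snd z)) \<longlongrightarrow> a x1) ?F"
      using tendsto_mult_group[OF fst tendsto_a[OF snd x1]] by simp
    note D3 = eventually_D[OF this tendsto_\<zeta>[OF snd x1] frame_in(3)[OF x1]]
    have "(\<one>, x1) \<in> D" using x1 A_subset one_D by blast
    note D2 = eventually_D[OF fst snd this]
    show "\<forall>\<^sub>F z in ?F. snd z \<in> A \<longrightarrow>
        frame_field v (\<phi> (fst z) (snd z)) = frechet_derivative (\<phi> (fst z)) (at (snd z)) (frame_field v (snd z))"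
      using eventually_equivariant[OF x1 fst snd] D2 D3 eventually_chart[OF fst one_in_chart] eventually_A[OF snd x1]
    proof eventually_elim
      case (elim z)
      note fr = frame_in[OF elim(5)] frame_act[OF elim(5)]
      have "frechet_derivative (\<phi> (fst z \<otimes> a (snd z))) (at (\<zeta> (snd z))) v =
          frechet_derivative (\<phi> (fst z)) (at (snd z)) (frechet_derivative (\<phi> (a (snd z))) (at (\<zeta> (snd z))) v)"
        using act_derivative_compose[of "a (snd z)" "\<zeta> (snd z)" "fst z" v] fr elim by simp
      then show ?case using elim(1) by (simp add: frame_field_def)
    qed
  qed
qed

lemma invariant_frame_frame_field:
  assumes "S \<subseteq> A"
  shows "invariant_frame \<one> \<phi> S (\<lambda>i. frame_field (axis i 1))"
  unfolding invariant_frame_def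
proof (intro conjI allI ballI)
  show "invariant_vector_field \<one> \<phi> S (frame_field (axis i 1))" for i
    using invariant_frame_field near_identity_subset[OF _ assms] smooth_on_subset[OF _ assms]
    unfolding invariant_vector_field_def by blast
  fix x assume "x \<in> S"
  then have x: "x \<in> A" using assms by blast
  have inj: "inj (\<lambda>v. frame_field v x)"
    using frame_field_inverse(1)[OF x] by (metis injI)
  have range: "range (\<lambda>i. frame_field (axis i 1) x) = (\<lambda>v. frame_field v x) ` range (\<lambda>i. axis i 1)"
    by (simp add: image_image)
  show "inj (\<lambda>i. frame_field (axis i 1) x)"
  proof (rule injI)
    fix i j assume "frame_field (axis i 1) x = frame_field (axis j 1) x"
    from injD[OF inj this] show "i = j" by (simp add: axis_eq_axis)
  qed
  have "range (\<lambda>i. axis i (1::real)) = (Basis :: (real^'n) set)"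
    by (auto simp: Basis_vec_def)
  moreover have "independent ((\<lambda>v. frame_field v x) ` Basis)"
    by (rule linear_independent_injective_image[OF linear_frame_field[OF x] independent_Basis
          inj_on_subset[OF inj subset_UNIV]])
  ultimately show "independent (range (\<lambda>i. frame_field (axis i 1) x))"
    by (simp only: range not_False_eq_True)
qed

text \<open>Pulling \<open>w\<close> back from \<open>x\<close> to the section point turns the frame
  into the standard basis, so the coefficients of \<open>w\<close> are the coordinates of the
  pulled-back vector.\<close>

lemma frame_field_expansion:
  assumes "x \<in> A"
  shows "(\<Sum>i\<in>UNIV. frechet_derivative (\<phi> (inv (a x))) (at x) w $ i *\<^sub>R frame_field (axis i 1) x) = w"
proof -
  let ?v = "frechet_derivative (\<phi> (inv (a x))) (at x) w"
  note lin = linear_frame_field[OF assms]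
  have "(\<Sum>i\<in>UNIV. ?v $ i *\<^sub>R frame_field (axis i 1) x) = frame_field (\<Sum>i\<in>UNIV. ?v $ i *\<^sub>R axis i 1) x"
    by (simp only: linear_sum[OF lin] linear_scale[OF lin])
  also have "(\<Sum>i\<in>UNIV. ?v $ i *\<^sub>R axis i 1) = ?v"
    using basis_expansion[of ?v] by (simp only: scalar_mult_eq_scaleR)
  also have "frame_field ?v x = w"
    by (rule frame_field_inverse(2)[OF assms])
  finally show ?thesis .
qed

end

section \<open>Invariant functions and output errors\<close>

lemma mem_interior_iff_eventually: "z \<in> interior S \<longleftrightarrow> (\<forall>\<^sub>F z in nhds z. z \<in> S)"
  by (auto simp: interior_def eventually_nhds)

context moving_frame
begin

lemma smooth_on_normalized:
  fixes x :: "'z::real_normed_vector \<Rightarrow> real^'n" and y :: "'z \<Rightarrow> 'b::euclidean_space"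
  assumes "charted_action G \<A> V c \<Sigma>' D' \<theta>"
    and S: "open S" "smooth_on S x" "smooth_on S y" "\<And>z. z \<in> S \<Longrightarrow> x z \<in> A"
    and dom: "\<And>z. z \<in> S \<Longrightarrow> (inv (a (x z)), y z) \<in> D'"
  shows "smooth_on S (\<lambda>z. \<theta> (inv (a (x z))) (y z))"
proof -
  interpret \<theta>: charted_action G \<A> V c \<Sigma>' D' \<theta> by fact
  have "smooth_on S (\<lambda>z. c (inv (a (x z))))"
    by (rule smooth_on_compose[OF smooth_inv_frame S(1) open_A S(2) S(4)])
  then show ?thesis
    by (rule \<theta>.smooth_on_act[OF S(1) _ S(3) frame_in(2)[OF S(4)] dom])
qed

end

section \<open>One state frame normalising states, inputs and outputs together\<close>

locale observer_frame = moving_frame G \<A> V c X D \<phi> A a \<zeta> K x0 +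
    inputs: charted_action G \<A> V c U DU \<psi> + outputs: charted_action G \<A> V c Y DY \<rho>
  for G :: "'g::{t2_space, second_countable_topology} monoid" (structure)
    and \<A> :: "('g set \<times> ('g \<Rightarrow> real^'r)) set" and V c
    and X :: "(real^'n) set" and D \<phi> A a \<zeta> K x0
    and U :: "(real^'m) set" and DU \<psi> and Y :: "(real^'p) set" and DY \<rho>
begin

definition normal_input :: "real^'n \<Rightarrow> real^'m \<Rightarrow> real^'m" where
  "normal_input x u = \<psi> (inv (a x)) u"

text \<open>The subtracted term is the output predicted at the normal form. It does not depend on
  \<open>y\<close>, so inverting in \<open>y\<close> only means undoing a translation and an
  action.\<close>

definition output_error :: "(real^'n \<Rightarrow> real^'m \<Rightarrow> real^'p) \<Rightarrow> real^'n \<Rightarrow> real^'m \<Rightarrow> real^'p \<Rightarrow> real^'p" where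
  "output_error h x u y = \<rho> (inv (a x)) y - h (\<zeta> x) (normal_input x u)"

lemma smooth_on_normal_input:
  fixes x :: "'z::real_normed_vector \<Rightarrow> real^'n" and u :: "'z \<Rightarrow> real^'m"
  assumes "open S" "smooth_on S x" "smooth_on S u" "\<And>z. z \<in> S \<Longrightarrow> x z \<in> A"
    and "\<And>z. z \<in> S \<Longrightarrow> (inv (a (x z)), u z) \<in> DU"
  shows "smooth_on S (\<lambda>z. normal_input (x z) (u z))"
  unfolding normal_input_def by (rule smooth_on_normalized[OF inputs.charted_action_axioms assms])

lemma tendsto_normal_input:
  assumes "(x \<longlongrightarrow> x1) F" "(u \<longlongrightarrow> u1) F" "x1 \<in> A" "(inv (a x1), u1) \<in> DU"
  shows "((\<lambda>z. normal_input (x z) (u z)) \<longlongrightarrow> normal_input x1 u1) F"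
  unfolding normal_input_def
  by (rule inputs.tendsto_act[OF tendsto_inv_group[OF tendsto_a[OF assms(1,3)]] assms(2,4) frame_in(2)[OF assms(3)]])

lemma normal_input_in: "(inv (a x), u) \<in> DU \<Longrightarrow> normal_input x u \<in> U"
  unfolding normal_input_def by (rule inputs.act_in)

lemma act_normal_input:
  "(inv (a x), u) \<in> DU \<Longrightarrow> (a x, normal_input x u) \<in> DU \<Longrightarrow> \<psi> (a x) (normal_input x u) = u"
  unfolding normal_input_def using inputs.act_inv_act[of "inv (a x)" u] by simp

text \<open>Both components are constant along orbits, hence so is any function of them. The map
  \<open>l\<close> will be a coordinate map for \<open>K \<times> UNIV\<close>; this is why the
  section point enters relative to \<open>x0\<close>.\<close>

lemma invariant_function_normal:
  fixes l :: "(real^'n) \<times> (real^'m) \<Rightarrow> real^'k"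
  assumes S: "open S" and dom: "\<And>x u. (x, u) \<in> S \<Longrightarrow> x \<in> A \<and> (inv (a x), u) \<in> DU" and l: "linear l"
  shows "invariant_function \<one> \<phi> \<psi> S (\<lambda>x u. l (\<zeta> x - x0, normal_input x u))"
  unfolding invariant_function_def
proof
  have dom': "fst z \<in> A" "(inv (a (fst z)), snd z) \<in> DU" if "z \<in> S" for z
    using dom[of "fst z" "snd z"] that by simp_all
  have fst: "smooth_on S fst" and snd: "smooth_on S snd"
    using smooth_on_fst[OF S smooth_on_ident[OF S]] smooth_on_snd[OF S smooth_on_ident[OF S]] by simp_all
  have "smooth_on S (\<lambda>z. (\<zeta> (fst z) - x0, normal_input (fst z) (snd z)))"
    by (rule smooth_on_Pair[OF S smooth_on_diff[OF S smooth_on_compose[OF frame_smooth(2) S open_A fst dom'(1)]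
            smooth_on_const] smooth_on_normal_input[OF S fst snd dom']])
  from smooth_on_compose[OF smooth_on_linear[OF open_UNIV l] S open_UNIV this]
  show "smooth_on S (\<lambda>(x, u). l (\<zeta> x - x0, normal_input x u))"
    by (simp add: split_def)
  show "near_identity \<one> S (\<lambda>g (x, u). l (\<zeta> (\<phi> g x) - x0, normal_input (\<phi> g x) (\<psi> g u)) =
      l (\<zeta> x - x0, normal_input x u))"
    unfolding near_identity_iff_eventually
  proof
    fix p assume p: "p \<in> S"
    let ?F = "nhds (\<one>, p)"
    have g: "(fst \<longlongrightarrow> \<one>) ?F" and x: "((\<lambda>z. fst (snd z)) \<longlongrightarrow> fst p) ?F" and u: "((\<lambda>z. snd (snd z)) \<longlongrightarrow> snd p) ?F"
      using tendsto_fst[OF filterlim_ident, of "(\<one>, p)"]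
        tendsto_fst[OF tendsto_snd[OF filterlim_ident, of "(\<one>, p)"]]
        tendsto_snd[OF tendsto_snd[OF filterlim_ident, of "(\<one>, p)"]] by simp_all
    show "\<forall>\<^sub>F z in ?F. snd z \<in> S \<longrightarrow> (case snd z of (x, u) \<Rightarrow>
        l (\<zeta> (\<phi> (fst z) x) - x0, normal_input (\<phi> (fst z) x) (\<psi> (fst z) u)) = l (\<zeta> x - x0, normal_input x u))"
      using eventually_equivariant[OF dom'(1)[OF p] g x]
        eventually_normalized_invariant[OF inputs.charted_action_axioms dom'[OF p] g x u]
      by eventually_elim (simp add: split_def normal_input_def)
  qed
qed

lemma full_rank_function_normal:
  fixes T :: "real^'k \<Rightarrow> (real^'n) \<times> (real^'m)"
  assumes S: "open S"
    and dom: "\<And>x u. (x, u) \<in> S \<Longrightarrow> x \<in> A \<and> (inv (a x), u) \<in> DU \<and> (a x, normal_input x u) \<in> DU"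
    and T: "linear T" "linear T'" "range T = K \<times> UNIV" "\<And>b. T' (T b) = b" "\<And>z. z \<in> K \<times> UNIV \<Longrightarrow> T (T' z) = z"
  shows "full_rank_function S (\<lambda>x u. T' (\<zeta> x - x0, normal_input x u))"
  unfolding full_rank_function_def
proof
  let ?I = "\<lambda>(x, u). T' (\<zeta> x - x0, normal_input x u)"
  fix p assume p: "p \<in> S"
  define x u where "x = fst p" and "u = snd p"
  have x: "x \<in> A" and u: "(inv (a x), u) \<in> DU" "(a x, normal_input x u) \<in> DU"
    using dom[of x u] p by (simp_all add: x_def u_def)
  define b where "b = T' (\<zeta> x - x0, normal_input x u)"
  have Tb: "T b = (\<zeta> x - x0, normal_input x u)"
    unfolding b_def by (rule T(5)) (simp add: frame_in(5)[OF x])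
  have T_K: "fst (T b) \<in> K" for b
    using T(3) by (metis mem_Times_iff rangeI)
  \<comment> \<open>With the group element \<open>a x\<close> frozen, \<open>\<sigma>\<close> is a local right inverse of the invariant, which gives the rank.\<close>
  define \<sigma> where "\<sigma> b = (\<phi> (a x) (x0 + fst (T b)), \<psi> (a x) (snd (T b)))" for b
  have \<sigma>b: "\<sigma> b = p"
    using act_normal_input[OF u] by (simp add: \<sigma>_def Tb frame_act[OF x]) (simp add: x_def u_def)
  have bl: "bounded_linear T" using T(1) by (simp add: linear_conv_bounded_linear)
  have id: "((\<lambda>b. b) \<longlongrightarrow> b) (nhds b)" by (rule filterlim_ident)
  have z: "((\<lambda>b. x0 + fst (T b)) \<longlongrightarrow> \<zeta> x) (nhds b)" and n: "((\<lambda>b. snd (T b)) \<longlongrightarrow> normal_input x u) (nhds b)"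
    using tendsto_add[OF tendsto_const tendsto_fst[OF bounded_linear.tendsto[OF bl id]], of x0]
      tendsto_snd[OF bounded_linear.tendsto[OF bl id]] by (simp_all add: Tb)
  have "(\<lambda>b. \<phi> (a x) (x0 + fst (T b))) differentiable at b"
  proof -
    have "((\<lambda>b. x0 + fst (T b)) has_derivative (\<lambda>v. fst (T v))) (at b)"
      using bounded_linear.has_derivative[OF bl has_derivative_ident]
      by (auto intro!: derivative_eq_intros)
    moreover have "(\<phi> (a x) has_derivative frechet_derivative (\<phi> (a x)) (at (\<zeta> x))) (at (x0 + fst (T b)))"
      using has_frechet_derivative_act[OF frame_in(3)[OF x] frame_in(1)[OF x]] by (simp add: Tb)
    ultimately show ?thesis
      by (rule differentiableI[OF has_derivative_compose])
  qed
  moreover have "(\<lambda>b. \<psi> (a x) (snd (T b))) differentiable at b"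
  proof -
    have "((\<lambda>b. snd (T b)) has_derivative (\<lambda>v. snd (T v))) (at b)"
      using bounded_linear.has_derivative[OF bl has_derivative_ident]
      by (auto intro!: derivative_eq_intros)
    moreover have "(\<psi> (a x) has_derivative frechet_derivative (\<psi> (a x)) (at (snd (T b)))) (at (snd (T b)))"
      using inputs.has_frechet_derivative_act[OF u(2) frame_in(1)[OF x]] by (simp add: Tb)
    ultimately show ?thesis
      by (rule differentiableI[OF has_derivative_compose])
  qed
  ultimately have "\<sigma> differentiable at b"
    unfolding \<sigma>_def[abs_def] frechet_derivative_works[of "\<lambda>b. \<phi> (a x) (x0 + fst (T b))"]
      frechet_derivative_works[of "\<lambda>b. \<psi> (a x) (snd (T b))"] by (rule differentiableI[OF has_derivative_Pair])
  moreover have "\<forall>\<^sub>F b' in nhds b. ?I (\<sigma> b') = b'"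
  proof -
    have "((\<lambda>b. \<psi> (a x) (snd (T b))) \<longlongrightarrow> u) (nhds b)"
      using inputs.tendsto_act[OF tendsto_const n u(2) frame_in(1)[OF x]] act_normal_input[OF u] by simp
    note ev = inputs.eventually_D[OF tendsto_const this u(1)] inputs.eventually_D[OF tendsto_const n u(2)]
    \<comment> \<open>Along \<open>\<sigma>\<close> the frame keeps the value \<open>a x\<close>, so
      \<open>normal_input\<close> merely undoes \<open>\<psi> (a x)\<close>, and \<open>T'\<close>
      then returns \<open>b'\<close>.\<close>
    show ?thesis
      using eventually_compose_filterlim[OF frame_section[OF x] z] ev
    proof eventually_elim
      case (elim b')
      then have "normal_input (\<phi> (a x) (x0 + fst (T b'))) (\<psi> (a x) (snd (T b'))) = snd (T b')"
        using inputs.act_inv_act[OF elim(3,2)] T_K by (simp add: normal_input_def)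
      then show ?case using elim(1) T_K[of b'] by (simp add: \<sigma>_def T(4))
    qed
  qed
  moreover have "?I differentiable at (\<sigma> b)"
  proof -
    have "invariant_function \<one> \<phi> \<psi> S (\<lambda>x u. T' (\<zeta> x - x0, normal_input x u))"
      by (rule invariant_function_normal[OF S _ T(2)]) (use dom in blast)
    then show ?thesis
      using smooth_on_differentiable p \<sigma>b unfolding invariant_function_def by blast
  qed
  ultimately have "derivative_rank ?I (\<sigma> b) = DIM(real^'k)"
    by (intro derivative_rank_right_inverse)
  then show "derivative_rank ?I p = CARD('k)"
    by (simp add: \<sigma>b)
qed

text \<open>\<open>h_normal\<close> is equivariance of \<open>h\<close> at the group element
  \<open>inv (a x)\<close>. It enters as a hypothesis because equivariance is known only near the
  identity, so \<open>W\<close> must be chosen to guarantee it.\<close>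

lemma invariant_output_error_normal:
  assumes W: "open W"
    and dom: "\<And>x u y. (x, u, y) \<in> W \<Longrightarrow> x \<in> A \<and> (inv (a x), u) \<in> DU \<and> (inv (a x), y) \<in> DY \<and> (a x, \<rho> (inv (a x)) y) \<in> DY"
    and h: "smooth_on (X \<times> U) (\<lambda>(x, u). h x u)"
    and h_normal: "\<And>x u. (x, u, h x u) \<in> W \<Longrightarrow> h (\<zeta> x) (normal_input x u) = \<rho> (inv (a x)) (h x u)"
  shows "invariant_output_error \<one> \<phi> \<psi> \<rho> h W (output_error h)"
  unfolding invariant_output_error_def
proof (intro conjI allI impI)
  have dom': "fst z \<in> A" "(inv (a (fst z)), fst (snd z)) \<in> DU" "(inv (a (fst z)), snd (snd z)) \<in> DY"
    if "z \<in> W" for z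
    using dom[of "fst z" "fst (snd z)" "snd (snd z)"] that by simp_all
  note id = smooth_on_ident[OF W]
  note x = smooth_on_fst[OF W id] and u = smooth_on_fst[OF W smooth_on_snd[OF W id]]
    and y = smooth_on_snd[OF W smooth_on_snd[OF W id]]
  have "smooth_on W (\<lambda>z. h (\<zeta> (fst z)) (normal_input (fst z) (fst (snd z))))"
  proof (rule smooth_on_compose2[OF h W])
    show "open (X \<times> U)" by (intro open_Times open_\<Sigma> inputs.open_\<Sigma>)
    show "smooth_on W (\<lambda>z. \<zeta> (fst z))"
      by (rule smooth_on_compose[OF frame_smooth(2) W open_A x dom'(1)])
    show "smooth_on W (\<lambda>z. normal_input (fst z) (fst (snd z)))"
      by (rule smooth_on_normal_input[OF W x u dom'(1,2)])
    show "(\<zeta> (fst z), normal_input (fst z) (fst (snd z))) \<in> X \<times> U" if "z \<in> W" for z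
      using dom'[OF that] frame_in(3) D_subset normal_input_in by blast
  qed
  from smooth_on_diff[OF W smooth_on_normalized[OF outputs.charted_action_axioms W x y dom'(1,3)] this]
  show "smooth_on W (\<lambda>(x, u, y). output_error h x u y)"
    by (simp add: output_error_def split_def)
next
  fix x u
  let ?S = "{y. (x, u, y) \<in> W}"
  have "?S = (\<lambda>y. (x, u, y)) -` W" by auto
  then have S: "open ?S" by (simp only:) (intro open_vimage W continuous_intros)
  show "smoothly_invertible_on ?S (output_error h x u)"
  \<comment> \<open>The definition quantifies over all \<open>x\<close> and \<open>u\<close>. Over
    an empty fibre nothing is known about \<open>x\<close>, not even that it lies in
    \<open>A\<close>.\<close>
  proof (cases "?S = {}")
    case True
    then show ?thesis by (simp add: smoothly_invertible_on_def smooth_on_empty)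
  next
    case False
    then have x: "x \<in> A" using dom by blast
    show ?thesis
      unfolding output_error_def[abs_def]
      by (rule outputs.smoothly_invertible_act_translate[OF S frame_in(2)[OF x]])
        (use dom frame_in(1)[OF x] in simp_all)
  qed
next
  fix x u assume "(x, u, h x u) \<in> W"
  then show "output_error h x u (h x u) = 0" by (simp add: output_error_def h_normal)
next
  show "near_identity \<one> W (\<lambda>g (x, u, y). output_error h (\<phi> g x) (\<psi> g u) (\<rho> g y) = output_error h x u y)"
    unfolding near_identity_iff_eventually
  proof
    fix p assume p: "p \<in> W"
    let ?F = "nhds (\<one>, p)"
    have dom_p: "fst p \<in> A" "(inv (a (fst p)), fst (snd p)) \<in> DU" "(inv (a (fst p)), snd (snd p)) \<in> DY"
      using dom[of "fst p" "fst (snd p)" "snd (snd p)"] p by simp_all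
    have g: "(fst \<longlongrightarrow> \<one>) ?F" and x: "((\<lambda>z. fst (snd z)) \<longlongrightarrow> fst p) ?F"
      and u: "((\<lambda>z. fst (snd (snd z))) \<longlongrightarrow> fst (snd p)) ?F"
      and y: "((\<lambda>z. snd (snd (snd z))) \<longlongrightarrow> snd (snd p)) ?F"
      using tendsto_fst[OF filterlim_ident, of "(\<one>, p)"]
        tendsto_fst[OF tendsto_snd[OF filterlim_ident, of "(\<one>, p)"]]
        tendsto_fst[OF tendsto_snd[OF tendsto_snd[OF filterlim_ident, of "(\<one>, p)"]]]
        tendsto_snd[OF tendsto_snd[OF tendsto_snd[OF filterlim_ident, of "(\<one>, p)"]]] by simp_all
    show "\<forall>\<^sub>F z in ?F. snd z \<in> W \<longrightarrow> (case snd z of (x, u, y) \<Rightarrow>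
        output_error h (\<phi> (fst z) x) (\<psi> (fst z) u) (\<rho> (fst z) y) = output_error h x u y)"
      using eventually_equivariant[OF dom_p(1) g x]
        eventually_normalized_invariant[OF inputs.charted_action_axioms dom_p(1,2) g x u]
        eventually_normalized_invariant[OF outputs.charted_action_axioms dom_p(1,3) g x y]
      by eventually_elim (simp add: split_def normal_input_def output_error_def)
  qed
qed

end

section \<open>Normal form of invariant pre-observers\<close>

text \<open>\<open>K\<close> has dimension n - r, so \<open>K \<times> UNIV\<close> has dimension n
  + m - r, that of \<open>real^'k\<close>. The map \<open>T'\<close> compresses the pair of section
  point and normal input to exactly this many components.\<close>

lemma subspace_coordinates:
  fixes K :: "(real^'n) set"
  assumes "subspace K" "dim K + CARD('r::finite) = CARD('n)" "CARD('k::finite) = CARD('n) + CARD('m::finite) - CARD('r)"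
  obtains T :: "real^'k \<Rightarrow> (real^'n) \<times> (real^'m)" and T'
  where "linear T" "linear T'" "range T = K \<times> UNIV" "\<And>b. T' (T b) = b" "\<And>z. z \<in> K \<times> UNIV \<Longrightarrow> T (T' z) = z"
proof -
  have "subspace (K \<times> (UNIV :: (real^'m) set))"
    by (intro subspace_Times assms(1) subspace_UNIV)
  moreover have "dim (UNIV :: (real^'k) set) = dim (K \<times> (UNIV :: (real^'m) set))"
    using assms(2,3) dim_Times[OF assms(1) subspace_UNIV, where 'b = "real^'m"] by simp
  ultimately show ?thesis
    using isometries_subspaces[OF subspace_UNIV, of "K \<times> (UNIV :: (real^'m) set)", where 'a = "real^'k"] that
    by (metis UNIV_I)
qed

context observer_frame
begin

lemma linear_inv_frame_derivative:
  "x \<in> A \<Longrightarrow> linear (frechet_derivative (\<phi> (inv (a x))) (at x))"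
  using linear_act_derivative frame_in by blast

lemma invariant_pre_observer_form:
  fixes f :: "real^'n \<Rightarrow> real^'m \<Rightarrow> real^'n" and h :: "real^'n \<Rightarrow> real^'m \<Rightarrow> real^'p"
    and F :: "real^'n \<Rightarrow> real^'m \<Rightarrow> real^'p \<Rightarrow> real^'n" and W\<^sub>0
  assumes card_k: "CARD('k::finite) = CARD('n) + CARD('m) - CARD('r)"
    and f: "smooth_on (X \<times> U) (\<lambda>(x, u). f x u)"
    and h: "smooth_on (X \<times> U) (\<lambda>(x, u). h x u)" and h_in: "\<forall>x\<in>X. \<forall>u\<in>U. h x u \<in> Y"
    and f_inv: "invariant_system \<one> \<phi> \<psi> (X \<times> U) f"
    and h_equi: "equivariant_output \<one> \<phi> \<psi> \<rho> (X \<times> U) h"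
    and F: "smooth_on (X \<times> U \<times> Y) (\<lambda>(x, u, y). F x u y)"
    and u0: "u0 \<in> U"
    and W0: "open W\<^sub>0" "{x0} \<times> {u0} \<times> Y \<subseteq> W\<^sub>0"
    and obs: "invariant_pre_observer \<one> \<phi> \<psi> \<rho> f h W\<^sub>0 F"
  shows "\<exists>A B W E (I :: real^'n \<Rightarrow> real^'m \<Rightarrow> real^'k) \<Lambda> (L :: 'n \<Rightarrow> real^'k \<Rightarrow> real^'p \<Rightarrow> real) w.
          open A \<and> open B \<and> x0 \<in> A \<and> u0 \<in> B \<and> A \<subseteq> X \<and> B \<subseteq> U \<and>
          open W \<and> W \<subseteq> A \<times> B \<times> Y \<and> {x0} \<times> {u0} \<times> Y \<subseteq> W \<and>
          (\<forall>x\<in>A. \<forall>u\<in>B. (x, u, h x u) \<in> W) \<and>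
          invariant_output_error \<one> \<phi> \<psi> \<rho> h W E \<and>
          invariant_function \<one> \<phi> \<psi> (A \<times> B) I \<and> full_rank_function (A \<times> B) I \<and>
          invariant_frame \<one> \<phi> A w \<and>
          open \<Lambda> \<and> (\<forall>(x, u, y)\<in>W. (I x u, E x u y) \<in> \<Lambda>) \<and>
          (\<forall>i. smooth_on \<Lambda> (\<lambda>(a, b). L i a b)) \<and>
          (\<forall>i. \<forall>x\<in>A. \<forall>u\<in>B. L i (I x u) 0 = 0) \<and>
          (\<forall>(x, u, y)\<in>W. F x u y = f x u + (\<Sum>i\<in>UNIV. L i (I x u) (E x u y) *\<^sub>R w i x))"
proof -
  define d where "d x = frechet_derivative (\<phi> (inv (a x))) (at x)" for x
  \<comment> \<open>Collects what must hold at a point with a free output \<open>y\<close>. The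
    conditions on the input, and those on the predicted output, are dealt with by the neighbourhood
    \<open>\<Omega>\<close> below.\<close>
  define P where "P z \<longleftrightarrow> (case z of (x, u, y) \<Rightarrow> x \<in> A \<and> (inv (a x), y) \<in> DY \<and> (a x, \<rho> (inv (a x)) y) \<in> DY \<and>
      F (\<zeta> x) (normal_input x u) (\<rho> (inv (a x)) y) = d x (F x u y))" for z
  define W\<^sub>1 where "W\<^sub>1 = interior {z. P z}"
  have x0X: "x0 \<in> X" using x0_in A_subset by blast
  have u0_dom: "(inv (a x0), u0) \<in> DU"
    by (simp add: frame_base inputs.one_D u0)
  have nu0: "normal_input x0 u0 = u0"
    by (simp add: normal_input_def frame_base inputs.act_one u0)
  have obs_eq: "\<And>x u. (x, u, h x u) \<in> W\<^sub>0 \<Longrightarrow> F x u (h x u) = f x u"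
    and obs_inv: "near_identity \<one> W\<^sub>0 (\<lambda>g (x, u, y).
       F (\<phi> g x) (\<psi> g u) (\<rho> g y) = frechet_derivative (\<phi> g) (at x) (F x u y))"
    using obs by (simp_all add: invariant_pre_observer_def pre_observer_def)
  \<comment> \<open>Over \<open>x0\<close> the normalising element is the identity whatever
    \<open>y\<close> is, so \<open>P\<close> holds near every single \<open>(x0, u0, y)\<close>.
    Taking the interior gathers these neighbourhoods, whose sizes may vary with
    \<open>y\<close>.\<close>
  have base_W1: "(x0, u0, y) \<in> W\<^sub>1" if y: "y \<in> Y" for y
  proof -
    let ?F = "nhds (x0, u0, y)"
    have id: "((\<lambda>z. z) \<longlongrightarrow> (x0, u0, y)) ?F" by (rule filterlim_ident)
    have xl: "(fst \<longlongrightarrow> x0) ?F" and yl: "((\<lambda>z. snd (snd z)) \<longlongrightarrow> y) ?F"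
      using tendsto_fst[OF id] tendsto_snd[OF tendsto_snd[OF id]] by simp_all
    have al: "((\<lambda>z. a (fst z)) \<longlongrightarrow> \<one>) ?F" and il: "((\<lambda>z. inv (a (fst z))) \<longlongrightarrow> \<one>) ?F"
      using tendsto_a[OF xl x0_in] tendsto_inv_group[OF tendsto_a[OF xl x0_in]] by (simp_all add: frame_base)
    have rl: "((\<lambda>z. \<rho> (inv (a (fst z))) (snd (snd z))) \<longlongrightarrow> y) ?F"
      using outputs.tendsto_act[OF il yl outputs.one_D[OF y] one_in_chart] by (simp add: outputs.act_one y)
    have zW: "(x0, u0, y) \<in> W\<^sub>0" using W0(2) y by blast
    have "\<forall>\<^sub>F z in ?F. P z"
      using eventually_A[OF xl x0_in] outputs.eventually_D[OF il yl outputs.one_D[OF y]]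
        outputs.eventually_D[OF al rl outputs.one_D[OF y]]
        near_identity_eventually[OF obs_inv zW il id] topological_tendstoD[OF id W0(1) zW]
      by eventually_elim (auto simp: P_def split_def d_def act_inv_frame normal_input_def)
    then show ?thesis by (simp add: W\<^sub>1_def mem_interior_iff_eventually)
  qed
  have hy0: "h x0 u0 \<in> Y" using h_in x0X u0 by blast
  let ?F = "nhds (x0, u0)"
  \<comment> \<open>The last two memberships have different uses: the normalised point in
    \<open>W\<^sub>0\<close> allows the pre-observer identity \<open>F = f\<close> at the normal
    form, and the point in \<open>W\<^sub>1\<close> keeps the graph of \<open>h\<close> inside the
    final domain.\<close>
  have "\<forall>\<^sub>F z in ?F. fst z \<in> A \<and> snd z \<in> U \<and> (inv (a (fst z)), snd z) \<in> DU \<and>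
      (a (fst z), normal_input (fst z) (snd z)) \<in> DU \<and>
      f (\<zeta> (fst z)) (normal_input (fst z) (snd z)) = d (fst z) (f (fst z) (snd z)) \<and>
      h (\<zeta> (fst z)) (normal_input (fst z) (snd z)) = \<rho> (inv (a (fst z))) (h (fst z) (snd z)) \<and>
      (\<zeta> (fst z), normal_input (fst z) (snd z), h (\<zeta> (fst z)) (normal_input (fst z) (snd z))) \<in> W\<^sub>0 \<and>
      (fst z, snd z, h (fst z) (snd z)) \<in> W\<^sub>1"
  proof -
    have id: "((\<lambda>z. z) \<longlongrightarrow> (x0, u0)) ?F" by (rule filterlim_ident)
    have xl: "(fst \<longlongrightarrow> x0) ?F" and ul: "(snd \<longlongrightarrow> u0) ?F"
      using tendsto_fst[OF id] tendsto_snd[OF id] by simp_all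
    have al: "((\<lambda>z. a (fst z)) \<longlongrightarrow> \<one>) ?F" and il: "((\<lambda>z. inv (a (fst z))) \<longlongrightarrow> \<one>) ?F"
      using tendsto_a[OF xl x0_in] tendsto_inv_group[OF tendsto_a[OF xl x0_in]] by (simp_all add: frame_base)
    have zl: "((\<lambda>z. \<zeta> (fst z)) \<longlongrightarrow> x0) ?F"
      using tendsto_\<zeta>[OF xl x0_in] by (simp add: frame_base)
    have nl: "((\<lambda>z. normal_input (fst z) (snd z)) \<longlongrightarrow> u0) ?F"
      using tendsto_normal_input[OF xl ul x0_in u0_dom] by (simp add: nu0)
    have base: "(x0, u0) \<in> X \<times> U" using x0X u0 by blast
    have XU: "open (X \<times> U)" by (intro open_Times open_\<Sigma> inputs.open_\<Sigma>)
    have h_lim: "((\<lambda>z. h (x z) (u z)) \<longlongrightarrow> h x0 u0) ?F" if "(x \<longlongrightarrow> x0) ?F" "(u \<longlongrightarrow> u0) ?F" for x u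
      using continuous_on_tendsto_compose[OF smooth_on_continuous[OF h] tendsto_Pair[OF that] base
          topological_tendstoD[OF tendsto_Pair[OF that] XU base]] by simp
    have W0_base: "(x0, u0, h x0 u0) \<in> W\<^sub>0" using W0(2) hy0 by blast
    have W1: "open W\<^sub>1" by (simp add: W\<^sub>1_def)
    show ?thesis
      using eventually_A[OF xl x0_in] topological_tendstoD[OF ul inputs.open_\<Sigma> u0]
        inputs.eventually_D[OF il ul inputs.one_D[OF u0]] inputs.eventually_D[OF al nl inputs.one_D[OF u0]]
        near_identity_eventually[OF f_inv[unfolded invariant_system_def] base il id]
        near_identity_eventually[OF h_equi[unfolded equivariant_output_def] base il id]
        topological_tendstoD[OF tendsto_Pair[OF zl tendsto_Pair[OF nl h_lim[OF zl nl]]] W0(1) W0_base]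
        topological_tendstoD[OF tendsto_Pair[OF xl tendsto_Pair[OF ul h_lim[OF xl ul]]] W1 base_W1[OF hy0]]
    proof eventually_elim
      case (elim z)
      have "z \<in> X \<times> U" using elim(1,2) A_subset by (auto simp: mem_Times_iff)
      then show ?case
        using elim by (auto simp: split_def d_def act_inv_frame normal_input_def)
    qed
  qed
  then obtain \<Omega> where \<Omega>_open: "open \<Omega>" "(x0, u0) \<in> \<Omega>" and \<Omega>: "\<And>z. z \<in> \<Omega> \<Longrightarrow> fst z \<in> A \<and> snd z \<in> U \<and>
      (inv (a (fst z)), snd z) \<in> DU \<and> (a (fst z), normal_input (fst z) (snd z)) \<in> DU \<and>
      f (\<zeta> (fst z)) (normal_input (fst z) (snd z)) = d (fst z) (f (fst z) (snd z)) \<and>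
      h (\<zeta> (fst z)) (normal_input (fst z) (snd z)) = \<rho> (inv (a (fst z))) (h (fst z) (snd z)) \<and>
      (\<zeta> (fst z), normal_input (fst z) (snd z), h (\<zeta> (fst z)) (normal_input (fst z) (snd z))) \<in> W\<^sub>0 \<and>
      (fst z, snd z, h (fst z) (snd z)) \<in> W\<^sub>1"
    unfolding eventually_nhds by blast
  obtain A\<^sub>1 B where box: "open A\<^sub>1" "open B" "(x0, u0) \<in> A\<^sub>1 \<times> B" "A\<^sub>1 \<times> B \<subseteq> \<Omega>"
    using open_prod_elim[OF \<Omega>_open] by blast
  then have AB: "open A\<^sub>1" "x0 \<in> A\<^sub>1" "open B" "u0 \<in> B" by auto
  have Q: "x \<in> A \<and> u \<in> U \<and> (inv (a x), u) \<in> DU \<and> (a x, normal_input x u) \<in> DU \<and>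
      f (\<zeta> x) (normal_input x u) = d x (f x u) \<and> h (\<zeta> x) (normal_input x u) = \<rho> (inv (a x)) (h x u) \<and>
      (\<zeta> x, normal_input x u, h (\<zeta> x) (normal_input x u)) \<in> W\<^sub>0 \<and> (x, u, h x u) \<in> W\<^sub>1"
    if "x \<in> A\<^sub>1" "u \<in> B" for x u
    using \<Omega>[of "(x, u)"] box(4) that by auto
  have A1: "A\<^sub>1 \<subseteq> A" using Q AB(4) by blast
  define W where "W = W\<^sub>1 \<inter> A\<^sub>1 \<times> B \<times> UNIV"
  have W: "open W" unfolding W_def W\<^sub>1_def by (intro open_Int open_interior open_Times AB open_UNIV)
  have W_dom: "x \<in> A\<^sub>1" "u \<in> B" "P (x, u, y)" if "(x, u, y) \<in> W" for x u y
    using that interior_subset by (auto simp: W_def W\<^sub>1_def)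
  obtain T :: "real^'k \<Rightarrow> (real^'n) \<times> (real^'m)" and T'
    where T: "linear T" "linear T'" "range T = K \<times> UNIV" "\<And>b. T' (T b) = b" "\<And>z. z \<in> K \<times> UNIV \<Longrightarrow> T (T' z) = z"
    using subspace_coordinates[OF subspace_K dim_K card_k] by blast
  define I where "I x u = T' (\<zeta> x - x0, normal_input x u)" for x u
  \<comment> \<open>\<open>Z\<close> and \<open>N\<close> read the section point and the normal
    input back from a value of the invariant.\<close>
  define Z where "Z p = x0 + fst (T p)" for p
  define N where "N p = snd (T p)" for p
  have ZN: "Z (I x u) = \<zeta> x" "N (I x u) = normal_input x u" if "x \<in> A" for x u
    using T(5)[of "(\<zeta> x - x0, normal_input x u)"] frame_in(5)[OF that] by (simp_all add: Z_def N_def I_def)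
  define \<Lambda>\<^sub>1 where "\<Lambda>\<^sub>1 = {q :: (real^'k) \<times> (real^'p). (Z (fst q), N (fst q)) \<in> X \<times> U}"
  \<comment> \<open>The domain on which the formula for \<open>L\<close> evaluates \<open>F\<close>,
    \<open>f\<close> and \<open>h\<close> only inside \<open>X\<close>, \<open>U\<close> and
    \<open>Y\<close>.\<close>
  define \<Lambda> where "\<Lambda> = {q \<in> \<Lambda>\<^sub>1. snd q + h (Z (fst q)) (N (fst q)) \<in> Y}"
  \<comment> \<open>Adding \<open>h (Z p) (N p)\<close> to the error restores the normalised output,
    so this is a coordinate of \<open>F - f\<close> at the normal form. For \<open>b = 0\<close> the
    output is the predicted one, where the pre-observer identity makes the difference
    vanish.\<close>
  define L where "L i p b = (F (Z p) (N p) (b + h (Z p) (N p)) - f (Z p) (N p)) $ i" for i p b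
  have XU: "open (X \<times> U)" by (intro open_Times open_\<Sigma> inputs.open_\<Sigma>)
  have Z_smooth: "smooth_on S (\<lambda>q. Z (fst q))" and N_smooth: "smooth_on S (\<lambda>q. N (fst q))"
    if S: "open S" for S :: "((real^'k) \<times> (real^'p)) set"
  proof -
    have "smooth_on S (\<lambda>q. T (fst q))"
      by (rule smooth_on_compose[OF smooth_on_linear[OF open_UNIV T(1)] S open_UNIV smooth_on_fst[OF S smooth_on_ident[OF S]]]) simp
    then show "smooth_on S (\<lambda>q. Z (fst q))" "smooth_on S (\<lambda>q. N (fst q))"
      unfolding Z_def N_def by (intro smooth_on_add smooth_on_const smooth_on_fst smooth_on_snd S; assumption)+
  qed
  have \<Lambda>1: "open \<Lambda>\<^sub>1"
  proof -
    have "\<Lambda>\<^sub>1 = (\<lambda>q. (Z (fst q), N (fst q))) -` (X \<times> U)" by (auto simp: \<Lambda>\<^sub>1_def)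
    then show ?thesis
      by (simp only:) (intro open_vimage XU continuous_on_Pair smooth_on_continuous Z_smooth N_smooth open_UNIV)
  qed
  have h_smooth: "smooth_on S (\<lambda>q. h (Z (fst q)) (N (fst q)))" if "open S" "S \<subseteq> \<Lambda>\<^sub>1" for S
    by (rule smooth_on_compose2[OF h that(1) XU Z_smooth[OF that(1)] N_smooth[OF that(1)]])
      (use that(2) in \<open>auto simp: \<Lambda>\<^sub>1_def\<close>)
  have f_smooth: "smooth_on S (\<lambda>q. f (Z (fst q)) (N (fst q)))" if "open S" "S \<subseteq> \<Lambda>\<^sub>1" for S
    by (rule smooth_on_compose2[OF f that(1) XU Z_smooth[OF that(1)] N_smooth[OF that(1)]])
      (use that(2) in \<open>auto simp: \<Lambda>\<^sub>1_def\<close>)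
  have y_smooth: "smooth_on S (\<lambda>q. snd q + h (Z (fst q)) (N (fst q)))" if "open S" "S \<subseteq> \<Lambda>\<^sub>1" for S
    by (rule smooth_on_add[OF that(1) smooth_on_snd[OF that(1) smooth_on_ident[OF that(1)]] h_smooth[OF that]])
  have \<Lambda>: "open \<Lambda>"
  proof -
    have "\<Lambda> = \<Lambda>\<^sub>1 \<inter> (\<lambda>q. snd q + h (Z (fst q)) (N (fst q))) -` Y" by (auto simp: \<Lambda>_def)
    then show ?thesis
      using continuous_open_preimage[OF smooth_on_continuous[OF y_smooth[OF \<Lambda>1 subset_refl]] \<Lambda>1 outputs.open_\<Sigma>]
      by simp
  qed
  have \<Lambda>_sub: "\<Lambda> \<subseteq> \<Lambda>\<^sub>1" by (auto simp: \<Lambda>_def)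
  have L_smooth: "smooth_on \<Lambda> (\<lambda>(p, b). L i p b)" for i
  proof -
    have triple: "smooth_on \<Lambda> (\<lambda>q. (Z (fst q), N (fst q), snd q + h (Z (fst q)) (N (fst q))))"
      by (intro smooth_on_Pair \<Lambda> Z_smooth N_smooth y_smooth \<Lambda>_sub)
    have XUY: "open (X \<times> U \<times> Y)" by (intro open_Times open_\<Sigma> inputs.open_\<Sigma> outputs.open_\<Sigma>)
    have "smooth_on \<Lambda> (\<lambda>q. (\<lambda>(x, u, y). F x u y) (Z (fst q), N (fst q), snd q + h (Z (fst q)) (N (fst q))))"
      by (rule smooth_on_compose[OF F \<Lambda> XUY triple]) (auto simp: \<Lambda>_def \<Lambda>\<^sub>1_def)
    then have "smooth_on \<Lambda> (\<lambda>q. F (Z (fst q)) (N (fst q)) (snd q + h (Z (fst q)) (N (fst q))))"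
      by simp
    from smooth_on_bounded_linear[OF \<Lambda> bounded_linear_vec_nth smooth_on_diff[OF \<Lambda> this f_smooth[OF \<Lambda> \<Lambda>_sub]]]
    show ?thesis by (simp add: L_def split_def)
  qed
  have in_\<Lambda>: "(I x u, output_error h x u y) \<in> \<Lambda>" if "(x, u, y) \<in> W" for x u y
  proof -
    have x: "x \<in> A" and "(inv (a x), u) \<in> DU" "(inv (a x), y) \<in> DY"
      using W_dom[OF that] Q by (auto simp: P_def)
    then show ?thesis
      using D_subset[OF frame_in(3)[OF x]] normal_input_in outputs.act_in
      by (simp add: \<Lambda>_def \<Lambda>\<^sub>1_def ZN output_error_def)
  qed
  have L0: "L i (I x u) 0 = 0" if "x \<in> A\<^sub>1" "u \<in> B" for i x u
  proof -
    have "F (\<zeta> x) (normal_input x u) (h (\<zeta> x) (normal_input x u)) = f (\<zeta> x) (normal_input x u)"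
      using Q[OF that] by (intro obs_eq) blast
    then show ?thesis using Q[OF that] by (simp add: L_def ZN)
  qed
  have expansion: "F x u y = f x u + (\<Sum>i\<in>UNIV. L i (I x u) (output_error h x u y) *\<^sub>R frame_field (axis i 1) x)"
    if "(x, u, y) \<in> W" for x u y
  proof -
    have x: "x \<in> A" and Px: "P (x, u, y)" and fx: "f (\<zeta> x) (normal_input x u) = d x (f x u)"
      using W_dom[OF that] Q by auto
    \<comment> \<open>By \<open>P\<close> for \<open>F\<close> and by \<open>fx\<close> for
      \<open>f\<close>, both terms at the normal form are images under \<open>d x\<close> of their
      values at \<open>x\<close>; linearity of \<open>d x\<close> combines them.\<close>
    have "L i (I x u) (output_error h x u y) = d x (F x u y - f x u) $ i" for i
      using Px fx linear_diff[OF linear_inv_frame_derivative[OF x], folded d_def]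
      by (simp add: L_def ZN x output_error_def P_def)
    then show ?thesis
      using frame_field_expansion[OF x, of "F x u y - f x u", folded d_def] by simp
  qed
  have W_sub: "W \<subseteq> A\<^sub>1 \<times> B \<times> Y"
    using W_dom outputs.D_subset by (fastforce simp: P_def)
  have "invariant_output_error \<one> \<phi> \<psi> \<rho> h W (output_error h)"
    by (rule invariant_output_error_normal[OF W _ h]) (use W_dom Q in \<open>auto simp: P_def\<close>)
  moreover have "invariant_function \<one> \<phi> \<psi> (A\<^sub>1 \<times> B) I"
    unfolding I_def[abs_def] by (rule invariant_function_normal[OF open_Times[OF AB(1,3)] _ T(2)]) (use Q in auto)
  moreover have "full_rank_function (A\<^sub>1 \<times> B) I"
    unfolding I_def[abs_def] by (rule full_rank_function_normal[OF open_Times[OF AB(1,3)] _ T]) (use Q in auto)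
  moreover have "invariant_frame \<one> \<phi> A\<^sub>1 (\<lambda>i. frame_field (axis i 1))"
    by (rule invariant_frame_frame_field[OF A1])
  moreover have "{x0} \<times> {u0} \<times> Y \<subseteq> W" "\<forall>x\<in>A\<^sub>1. \<forall>u\<in>B. (x, u, h x u) \<in> W"
    using base_W1 AB Q by (auto simp: W_def)
  moreover have "A\<^sub>1 \<subseteq> X" "B \<subseteq> U"
    using A1 A_subset Q AB(2) by blast+
  moreover have "\<forall>(x, u, y)\<in>W. (I x u, output_error h x u y) \<in> \<Lambda>"
    using in_\<Lambda> by blast
  moreover have "\<forall>(x, u, y)\<in>W.
      F x u y = f x u + (\<Sum>i\<in>UNIV. L i (I x u) (output_error h x u y) *\<^sub>R frame_field (axis i 1) x)"
    by (intro ballI, clarify) (rule expansion)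
  moreover have "\<forall>i. smooth_on \<Lambda> (\<lambda>(p, b). L i p b)" "\<forall>i. \<forall>x\<in>A\<^sub>1. \<forall>u\<in>B. L i (I x u) 0 = 0"
    by (intro allI L_smooth) (intro allI ballI L0)
  ultimately show ?thesis
    using AB W W_sub \<Lambda>
    by - (rule exI[of _ A\<^sub>1], rule exI[of _ B], rule exI[of _ W], rule exI[of _ "output_error h"], rule exI[of _ I],
        rule exI[of _ \<Lambda>], rule exI[of _ L], rule exI[of _ "\<lambda>i. frame_field (axis i 1)"], intro conjI; assumption)
qed

end

text \<open>Under a small \<open>g\<close> the coefficients do not change, since \<open>I\<close>
  and \<open>E\<close> are invariant, while \<open>f\<close> and each \<open>w i\<close> are
  multiplied by the linear map \<open>D(\<phi> g)\<close>; hence so is the whole sum. On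
  \<open>y = h x u\<close> the error is 0 and the correction disappears.\<close>

lemma invariant_pre_observer_of_form:
  fixes G :: "'g::{t2_space, second_countable_topology} monoid" (structure)
    and \<A> :: "('g set \<times> ('g \<Rightarrow> real^'r)) set"
    and I :: "real^'n \<Rightarrow> real^'m \<Rightarrow> real^'k" and L :: "'n \<Rightarrow> real^'k \<Rightarrow> real^'p \<Rightarrow> real"
  assumes "charted_action G \<A> V c X D \<phi>" "charted_action G \<A> V c U DU \<psi>" "charted_action G \<A> V c Y DY \<rho>"
    and f_inv: "invariant_system \<one> \<phi> \<psi> (X \<times> U) f"
    and F: "smooth_on (X \<times> U \<times> Y) (\<lambda>(x, u, y). F x u y)"
    and sub: "A \<subseteq> X" "B \<subseteq> U" "W \<subseteq> A \<times> B \<times> Y" and W: "open W"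
    and E: "invariant_output_error \<one> \<phi> \<psi> \<rho> h W E"
    and I: "invariant_function \<one> \<phi> \<psi> (A \<times> B) I"
    and w: "invariant_frame \<one> \<phi> A w"
    and L0: "\<And>i x u. x \<in> A \<Longrightarrow> u \<in> B \<Longrightarrow> L i (I x u) 0 = 0"
    and form: "\<And>x u y. (x, u, y) \<in> W \<Longrightarrow> F x u y = f x u + (\<Sum>i\<in>UNIV. L i (I x u) (E x u y) *\<^sub>R w i x)"
  shows "invariant_pre_observer \<one> \<phi> \<psi> \<rho> f h W F"
proof -
  interpret charted_action G \<A> V c X D \<phi> by fact
  interpret inputs: charted_action G \<A> V c U DU \<psi> by fact
  interpret outputs: charted_action G \<A> V c Y DY \<rho> by fact
  have E0: "\<And>x u. (x, u, h x u) \<in> W \<Longrightarrow> E x u (h x u) = 0"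
    and E_inv: "near_identity \<one> W (\<lambda>g (x, u, y). E (\<phi> g x) (\<psi> g u) (\<rho> g y) = E x u y)"
    using E by (simp_all add: invariant_output_error_def)
  have I_inv: "near_identity \<one> (A \<times> B) (\<lambda>g (x, u). I (\<phi> g x) (\<psi> g u) = I x u)"
    using I by (simp add: invariant_function_def)
  have w_inv: "near_identity \<one> A (\<lambda>g x. w i (\<phi> g x) = frechet_derivative (\<phi> g) (at x) (w i x))" for i
    using w by (simp add: invariant_frame_def invariant_vector_field_def)
  have "smooth_on W (\<lambda>(x, u, y). F x u y)"
    by (rule smooth_on_subset[OF F]) (use sub in blast)
  moreover have "F x u (h x u) = f x u" if "(x, u, h x u) \<in> W" for x u
  proof -
    have "x \<in> A" "u \<in> B" using that sub(3) by blast+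
    then show ?thesis using form[OF that] by (simp add: E0[OF that] L0)
  qed
  moreover have "near_identity \<one> W (\<lambda>g (x, u, y).
      F (\<phi> g x) (\<psi> g u) (\<rho> g y) = frechet_derivative (\<phi> g) (at x) (F x u y))"
    unfolding near_identity_iff_eventually
  proof
    fix p assume p: "p \<in> W"
    let ?F = "nhds (\<one>, p)"
    have pA: "fst p \<in> A" and pB: "fst (snd p) \<in> B" and pY: "snd (snd p) \<in> Y"
      using p sub(3) by auto
    have pX: "fst p \<in> X" and pU: "fst (snd p) \<in> U" using pA pB sub by blast+
    have g: "(fst \<longlongrightarrow> \<one>) ?F" and pl: "(snd \<longlongrightarrow> p) ?F" and x: "((\<lambda>z. fst (snd z)) \<longlongrightarrow> fst p) ?F"
      and u: "((\<lambda>z. fst (snd (snd z))) \<longlongrightarrow> fst (snd p)) ?F"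
      and y: "((\<lambda>z. snd (snd (snd z))) \<longlongrightarrow> snd (snd p)) ?F"
      using tendsto_fst[OF filterlim_ident, of "(\<one>, p)"] tendsto_snd[OF filterlim_ident, of "(\<one>, p)"]
        tendsto_fst[OF tendsto_snd[OF filterlim_ident, of "(\<one>, p)"]]
        tendsto_fst[OF tendsto_snd[OF tendsto_snd[OF filterlim_ident, of "(\<one>, p)"]]]
        tendsto_snd[OF tendsto_snd[OF tendsto_snd[OF filterlim_ident, of "(\<one>, p)"]]] by simp_all
    \<comment> \<open>The expansion of \<open>F\<close> is given on \<open>W\<close> only, so the
      displaced point has to stay in \<open>W\<close> before the expansion can be used
      there.\<close>
    have "((\<lambda>z. (\<phi> (fst z) (fst (snd z)), \<psi> (fst z) (fst (snd (snd z))), \<rho> (fst z) (snd (snd (snd z))))) \<longlongrightarrow> p) ?F"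
      using tendsto_Pair[OF tendsto_act[OF g x one_D[OF pX] one_in_chart]
          tendsto_Pair[OF inputs.tendsto_act[OF g u inputs.one_D[OF pU] one_in_chart]
            outputs.tendsto_act[OF g y outputs.one_D[OF pY] one_in_chart]]]
      by (simp add: act_one inputs.act_one outputs.act_one pX pU pY)
    note moved = topological_tendstoD[OF this W p]
    \<comment> \<open>The frame has finitely many fields, so a single neighbourhood serves all of
      them.\<close>
    have w_ev: "\<forall>\<^sub>F z in ?F. \<forall>i. fst (snd z) \<in> A \<longrightarrow> w i (\<phi> (fst z) (fst (snd z))) =
        frechet_derivative (\<phi> (fst z)) (at (fst (snd z))) (w i (fst (snd z)))"
      by (rule eventually_all_finite) (rule near_identity_eventually[OF w_inv pA g x])
    have AB: "(fst p, fst (snd p)) \<in> A \<times> B" and XU: "(fst p, fst (snd p)) \<in> X \<times> U"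
      using pA pB pX pU by auto
    show "\<forall>\<^sub>F z in ?F. snd z \<in> W \<longrightarrow> (case snd z of (x, u, y) \<Rightarrow>
        F (\<phi> (fst z) x) (\<psi> (fst z) u) (\<rho> (fst z) y) = frechet_derivative (\<phi> (fst z)) (at x) (F x u y))"
      using moved w_ev near_identity_eventually[OF I_inv AB g tendsto_Pair[OF x u]]
        near_identity_eventually[OF f_inv[unfolded invariant_system_def] XU g tendsto_Pair[OF x u]]
        near_identity_eventually[OF E_inv p g pl] eventually_D[OF g x one_D[OF pX]] eventually_chart[OF g one_in_chart]
    proof eventually_elim
      case (elim z)
      obtain g x u y where z: "z = (g, x, u, y)" by (metis surj_pair)
      show ?case
      proof
        assume "snd z \<in> W"
        then have xuy: "(x, u, y) \<in> W" "x \<in> A" "u \<in> B" "x \<in> X" "u \<in> U" using sub by (auto simp: z)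
        have lin: "linear (frechet_derivative (\<phi> g) (at x))"
          using elim(6,7) linear_act_derivative by (simp add: z)
        have "frechet_derivative (\<phi> g) (at x) (F x u y) = frechet_derivative (\<phi> g) (at x) (f x u) +
            (\<Sum>i\<in>UNIV. L i (I x u) (E x u y) *\<^sub>R frechet_derivative (\<phi> g) (at x) (w i x))"
          by (simp only: form[OF xuy(1)] linear_add[OF lin] linear_sum[OF lin] linear_scale[OF lin])
        moreover have "F (\<phi> g x) (\<psi> g u) (\<rho> g y) = f (\<phi> g x) (\<psi> g u) +
            (\<Sum>i\<in>UNIV. L i (I (\<phi> g x) (\<psi> g u)) (E (\<phi> g x) (\<psi> g u) (\<rho> g y)) *\<^sub>R w i (\<phi> g x))"
          by (rule form) (use elim(1) in \<open>simp add: z\<close>)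
        ultimately show "case snd z of (x, u, y) \<Rightarrow>
            F (\<phi> (fst z) x) (\<psi> (fst z) u) (\<rho> (fst z) y) = frechet_derivative (\<phi> (fst z)) (at x) (F x u y)"
          using elim(2-5) xuy by (simp add: z)
      qed
    qed
  qed
  ultimately show ?thesis
    by (simp add: invariant_pre_observer_def pre_observer_def)
qed

text \<open>Both sides are read as germs along
  \<open>{x\<^sub>0} \<times> {u\<^sub>0} \<times> Y\<close>. From left to right the domain is
  replaced by one over a small box \<open>A \<times> B\<close> around the base point; from right to
  left the given \<open>W\<close> is kept.\<close>

theorem theorem1:
  fixes G :: "'g::{t2_space, second_countable_topology} monoid"
    and \<A> :: "('g set \<times> ('g \<Rightarrow> real^'r)) set"
    and X :: "(real^'n) set" and U :: "(real^'m) set" and Y :: "(real^'p) set"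
    and \<phi> :: "'g \<Rightarrow> real^'n \<Rightarrow> real^'n" and D\<^sub>X :: "('g \<times> (real^'n)) set"
    and \<psi> :: "'g \<Rightarrow> real^'m \<Rightarrow> real^'m" and D\<^sub>U :: "('g \<times> (real^'m)) set"
    and \<rho> :: "'g \<Rightarrow> real^'p \<Rightarrow> real^'p" and D\<^sub>Y :: "('g \<times> (real^'p)) set"
    and f :: "real^'n \<Rightarrow> real^'m \<Rightarrow> real^'n"
    and h :: "real^'n \<Rightarrow> real^'m \<Rightarrow> real^'p"
    and F :: "real^'n \<Rightarrow> real^'m \<Rightarrow> real^'p \<Rightarrow> real^'n"
    and x\<^sub>0 :: "real^'n" and u\<^sub>0 :: "real^'m"
  assumes "open X" and "open U" and "open Y"
    and "CARD('p) \<le> CARD('n)" and "CARD('r) \<le> CARD('n)"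
    and "CARD('k::finite) = CARD('n) + CARD('m) - CARD('r)"
    and "lie_group G \<A>"
    and "local_transformation_group G \<A> X D\<^sub>X \<phi>"
    and "local_transformation_group G \<A> U D\<^sub>U \<psi>"
    and "local_transformation_group G \<A> Y D\<^sub>Y \<rho>"
    and "full_rank_action \<A> D\<^sub>X \<phi>"
    and "smooth_on (X \<times> U) (\<lambda>(x, u). f x u)"
    and "smooth_on (X \<times> U) (\<lambda>(x, u). h x u)" and "\<forall>x\<in>X. \<forall>u\<in>U. h x u \<in> Y"
    and "invariant_system \<one>\<^bsub>G\<^esub> \<phi> \<psi> (X \<times> U) f"
    and "equivariant_output \<one>\<^bsub>G\<^esub> \<phi> \<psi> \<rho> (X \<times> U) h"
    and "smooth_on (X \<times> U \<times> Y) (\<lambda>(x, u, y). F x u y)"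
    and "x\<^sub>0 \<in> X" and "u\<^sub>0 \<in> U"
  shows
    "(\<exists>W. open W \<and> W \<subseteq> X \<times> U \<times> Y \<and> {x\<^sub>0} \<times> {u\<^sub>0} \<times> Y \<subseteq> W \<and>
          invariant_pre_observer \<one>\<^bsub>G\<^esub> \<phi> \<psi> \<rho> f h W F)
     \<longleftrightarrow>
     (\<exists>A B W E (I :: real^'n \<Rightarrow> real^'m \<Rightarrow> real^'k) \<Lambda> (L :: 'n \<Rightarrow> real^'k \<Rightarrow> real^'p \<Rightarrow> real) w.
          open A \<and> open B \<and> x\<^sub>0 \<in> A \<and> u\<^sub>0 \<in> B \<and> A \<subseteq> X \<and> B \<subseteq> U \<and>
          open W \<and> W \<subseteq> A \<times> B \<times> Y \<and> {x\<^sub>0} \<times> {u\<^sub>0} \<times> Y \<subseteq> W \<and>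
          (\<forall>x\<in>A. \<forall>u\<in>B. (x, u, h x u) \<in> W) \<and>
          invariant_output_error \<one>\<^bsub>G\<^esub> \<phi> \<psi> \<rho> h W E \<and>
          invariant_function \<one>\<^bsub>G\<^esub> \<phi> \<psi> (A \<times> B) I \<and> full_rank_function (A \<times> B) I \<and>
          invariant_frame \<one>\<^bsub>G\<^esub> \<phi> A w \<and>
          open \<Lambda> \<and> (\<forall>(x, u, y)\<in>W. (I x u, E x u y) \<in> \<Lambda>) \<and>
          (\<forall>i. smooth_on \<Lambda> (\<lambda>(a, b). L i a b)) \<and>
          (\<forall>i. \<forall>x\<in>A. \<forall>u\<in>B. L i (I x u) 0 = 0) \<and>
          (\<forall>(x, u, y)\<in>W. F x u y = f x u + (\<Sum>i\<in>UNIV. L i (I x u) (E x u y) *\<^sub>R w i x)))"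
proof -
  interpret lie_group G \<A> by fact
  have "\<one>\<^bsub>G\<^esub> \<in> (\<Union>(V, c)\<in>\<A>. V)"
    using atlas by (simp add: smooth_atlas_def)
  then obtain V c where "(V, c) \<in> \<A>" "\<one>\<^bsub>G\<^esub> \<in> V" by blast
  then interpret charted_lie_group G \<A> V c by unfold_locales
  have state_action: "charted_action G \<A> V c X D\<^sub>X \<phi>" and input_action: "charted_action G \<A> V c U D\<^sub>U \<psi>"
    and output_action: "charted_action G \<A> V c Y D\<^sub>Y \<rho>"
    by (unfold_locales; fact)+
  obtain A a \<zeta> K where "moving_frame G \<A> V c X D\<^sub>X \<phi> A a \<zeta> K x\<^sub>0"
    using moving_frame_exists[OF state_action] assms by blast
  then have frame: "observer_frame G \<A> V c X D\<^sub>X \<phi> A a \<zeta> K x\<^sub>0 U D\<^sub>U \<psi> Y D\<^sub>Y \<rho>"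
    using input_action output_action by (simp add: observer_frame_def)
  show ?thesis (is "(\<exists>W. ?L W) \<longleftrightarrow> ?R")
  proof
    assume "\<exists>W. ?L W"
    then obtain W where W: "open W" "{x\<^sub>0} \<times> {u\<^sub>0} \<times> Y \<subseteq> W" "invariant_pre_observer \<one>\<^bsub>G\<^esub> \<phi> \<psi> \<rho> f h W F"
      by blast
    show ?R
      by (rule observer_frame.invariant_pre_observer_form[OF frame]; fact)
  next
    assume ?R
    then obtain A B W E and I :: "real^'n \<Rightarrow> real^'m \<Rightarrow> real^'k" and L :: "'n \<Rightarrow> real^'k \<Rightarrow> real^'p \<Rightarrow> real" and w
      where sub: "A \<subseteq> X" "B \<subseteq> U" "W \<subseteq> A \<times> B \<times> Y" "open W" and base: "{x\<^sub>0} \<times> {u\<^sub>0} \<times> Y \<subseteq> W"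
        and inv: "invariant_output_error \<one>\<^bsub>G\<^esub> \<phi> \<psi> \<rho> h W E" "invariant_function \<one>\<^bsub>G\<^esub> \<phi> \<psi> (A \<times> B) I"
          "invariant_frame \<one>\<^bsub>G\<^esub> \<phi> A w"
        and L: "\<forall>i. \<forall>x\<in>A. \<forall>u\<in>B. L i (I x u) 0 = 0"
        and form: "\<forall>(x, u, y)\<in>W. F x u y = f x u + (\<Sum>i\<in>UNIV. L i (I x u) (E x u y) *\<^sub>R w i x)"
      by (elim exE conjE) (rule that)
    have L0: "L i (I x u) 0 = 0" if "x \<in> A" "u \<in> B" for i x u
      using L that by blast
    have form': "F x u y = f x u + (\<Sum>i\<in>UNIV. L i (I x u) (E x u y) *\<^sub>R w i x)" if "(x, u, y) \<in> W" for x u y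
      using bspec[OF form that] by simp
    have "invariant_pre_observer \<one>\<^bsub>G\<^esub> \<phi> \<psi> \<rho> f h W F"
      by (rule invariant_pre_observer_of_form[OF state_action input_action output_action
            \<open>invariant_system \<one>\<^bsub>G\<^esub> \<phi> \<psi> (X \<times> U) f\<close> \<open>smooth_on (X \<times> U \<times> Y) (\<lambda>(x, u, y). F x u y)\<close>
            sub inv L0 form'])
    moreover have "W \<subseteq> X \<times> U \<times> Y" using sub by blast
    ultimately show "\<exists>W. ?L W" using sub(4) base by blast
  qed
qed

end
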